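(* Let $p$ be a prime, let $s \in \{0,1\}^{\mathbb{N}}$ be non-zero and suppose that $s$ is finitely supported. Then the locally compact group $\mathbb{F}_p(\!(t)\!) \times_{\eta_s} \mathbb{F}_p(\!(t)\!)$ is not type I.
   Context: $\mathbb{N}=\{1,2,3,\dots\}$. $\mathbb{F}_p(\!(t)\!)$ is the additive group of formal Laurent series with its usual locally compact topology. For $x=\sum_i x_it^i$, $y=\sum_i y_it^i$ in $\mathbb{F}_p(\!(t)\!)$ and $n\in\mathbb{N}$ put $\theta_n(x,y)=\sum_i x_iy_{i+n}t^i$, and for $s\in\{0,1\}^{\mathbb{N}}$ put $\eta_s(x,y)=\sum_{n=1}^\infty s(n)t^n\theta_{2n}(x,y)$. Each $\eta_s$ is a continuous bi-additive 2-cocycle. $\mathbb{F}_p(\!(t)\!)\times_{\eta_s}\mathbb{F}_p(\!(t)\!)$ denotes the corresponding central extension: the space $\mathbb{F}_p(\!(t)\!)\times\mathbb{F}_p(\!(t)\!)$ with the product topology and multiplication $(w,x)(y,z)=(w+y+\eta_s(x,z),\,x+z)$. A locally compact group is type I if every unitary representation of it generates a type I von Neumann algebra. *)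

theory Defs
  imports
    "HOL-Analysis.Analysis"
    "HOL-Algebra.Module"
    "HOL-Computational_Algebra.Formal_Laurent_Series"
    "Berlekamp_Zassenhaus.Finite_Field"
begin

section \<open>Hilbert spaces\<close>

definition complex_ring :: "complex ring" where
  "complex_ring = \<lparr>carrier = UNIV, mult = (*), one = 1, zero = 0, add = (+)\<rparr>"

text \<open>
  The distribution has no class of complex Hilbert spaces, and quantifying over all Hilbert spaces
  inside a formula calls for spaces that are values rather than types. A Hilbert space is therefore
  a record with an explicit carrier; the fields \<open>mult\<close> and \<open>one\<close> inherited from the
  algebra library's modules are unused and unconstrained.
\<close>

record 'h hilbert = "(complex, 'h) module" +
  cinner :: "'h \<Rightarrow> 'h \<Rightarrow> complex"

definition hnorm :: "('h, 'm) hilbert_scheme \<Rightarrow> 'h \<Rightarrow> real" where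
  "hnorm H v = sqrt (Re (cinner H v v))"

text \<open>
  The library's metric spaces require nonnegativity and symmetry off the carrier as well, whence
  the value \<open>0\<close> there.
\<close>

definition hdist :: "('h, 'm) hilbert_scheme \<Rightarrow> 'h \<Rightarrow> 'h \<Rightarrow> real" where
  "hdist H v w =
     (if v \<in> carrier H \<and> w \<in> carrier H then hnorm H (v \<ominus>\<^bsub>H\<^esub> w) else 0)"

definition norm_topology :: "('h, 'm) hilbert_scheme \<Rightarrow> 'h topology" where
  "norm_topology H = Metric_space.mtopology (carrier H) (hdist H)"

locale hilbert_space = Module.module complex_ring H for H :: "('h, 'm) hilbert_scheme" (structure) +
  assumes cinner_add_left:
      "\<lbrakk>u \<in> carrier H; v \<in> carrier H; w \<in> carrier H\<rbrakk>
        \<Longrightarrow> cinner H (u \<oplus> v) w = cinner H u w + cinner H v w"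
    and cinner_smult_left:
      "\<lbrakk>v \<in> carrier H; w \<in> carrier H\<rbrakk> \<Longrightarrow> cinner H (c \<odot>\<^bsub>H\<^esub> v) w = c * cinner H v w"
    and cinner_commute:
      "\<lbrakk>v \<in> carrier H; w \<in> carrier H\<rbrakk> \<Longrightarrow> cinner H w v = cnj (cinner H v w)"
    and cinner_pos:
      "\<lbrakk>v \<in> carrier H; v \<noteq> \<zero>\<rbrakk> \<Longrightarrow> Re (cinner H v v) > 0"
    and complete: "Metric_space.mcomplete (carrier H) (hdist H)"


section \<open>Bounded operators and von Neumann algebras\<close>

text \<open>
  Operators are extensional functions on the carrier, so that equality of operators is equality
  in HOL; the product of two operators is \<^const>\<open>compose\<close> on the carrier.
\<close>

definition bounded_operators :: "('h, 'm) hilbert_scheme \<Rightarrow> ('h \<Rightarrow> 'h) set" where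
  "bounded_operators H = {A \<in> carrier H \<rightarrow>\<^sub>E carrier H.
     (\<forall>v\<in>carrier H. \<forall>w\<in>carrier H. A (v \<oplus>\<^bsub>H\<^esub> w) = A v \<oplus>\<^bsub>H\<^esub> A w) \<and>
     (\<forall>c. \<forall>v\<in>carrier H. A (c \<odot>\<^bsub>H\<^esub> v) = c \<odot>\<^bsub>H\<^esub> A v) \<and>
     (\<exists>K. \<forall>v\<in>carrier H. hnorm H (A v) \<le> K * hnorm H v)}"

definition adjoint_pair ::
    "('h, 'm) hilbert_scheme \<Rightarrow> ('h \<Rightarrow> 'h) \<Rightarrow> ('h \<Rightarrow> 'h) \<Rightarrow> bool" where
  "adjoint_pair H A B \<longleftrightarrow>
     (\<forall>v\<in>carrier H. \<forall>w\<in>carrier H. cinner H (A v) w = cinner H v (B w))"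

definition commutant :: "('h, 'm) hilbert_scheme \<Rightarrow> ('h \<Rightarrow> 'h) set \<Rightarrow> ('h \<Rightarrow> 'h) set" where
  "commutant H S =
     {B \<in> bounded_operators H. \<forall>A\<in>S. compose (carrier H) A B = compose (carrier H) B A}"

definition von_neumann_algebra :: "('h, 'm) hilbert_scheme \<Rightarrow> ('h \<Rightarrow> 'h) set \<Rightarrow> bool" where
  "von_neumann_algebra H M \<longleftrightarrow> M \<subseteq> bounded_operators H \<and>
     (\<forall>A\<in>M. \<exists>B\<in>M. adjoint_pair H A B) \<and>
     commutant H (commutant H M) = M"

definition generated_von_neumann_algebra ::
    "('h, 'm) hilbert_scheme \<Rightarrow> ('h \<Rightarrow> 'h) set \<Rightarrow> ('h \<Rightarrow> 'h) set" where
  "generated_von_neumann_algebra H S = \<Inter>{M. von_neumann_algebra H M \<and> S \<subseteq> M}"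

definition zero_operator :: "('h, 'm) hilbert_scheme \<Rightarrow> 'h \<Rightarrow> 'h" where
  "zero_operator H = (\<lambda>v\<in>carrier H. \<zero>\<^bsub>H\<^esub>)"

definition projection :: "('h, 'm) hilbert_scheme \<Rightarrow> ('h \<Rightarrow> 'h) \<Rightarrow> bool" where
  "projection H P \<longleftrightarrow> P \<in> bounded_operators H \<and>
     compose (carrier H) P P = P \<and> adjoint_pair H P P"

definition projection_le ::
    "('h, 'm) hilbert_scheme \<Rightarrow> ('h \<Rightarrow> 'h) \<Rightarrow> ('h \<Rightarrow> 'h) \<Rightarrow> bool" where
  "projection_le H P Q \<longleftrightarrow> P ` carrier H \<subseteq> Q ` carrier H"

definition central_projection ::
    "('h, 'm) hilbert_scheme \<Rightarrow> ('h \<Rightarrow> 'h) set \<Rightarrow> ('h \<Rightarrow> 'h) \<Rightarrow> bool" where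
  "central_projection H M P \<longleftrightarrow> projection H P \<and> P \<in> M \<inter> commutant H M"

text \<open>A projection \<open>E\<close> in \<open>M\<close> is abelian if the algebra \<open>E M E\<close> is commutative.\<close>

definition abelian_projection ::
    "('h, 'm) hilbert_scheme \<Rightarrow> ('h \<Rightarrow> 'h) set \<Rightarrow> ('h \<Rightarrow> 'h) \<Rightarrow> bool" where
  "abelian_projection H M E \<longleftrightarrow> projection H E \<and> E \<in> M \<and>
     (let corner = (\<lambda>A. compose (carrier H) E (compose (carrier H) A E)) ` M in
      \<forall>A\<in>corner. \<forall>B\<in>corner. compose (carrier H) A B = compose (carrier H) B A)"

definition type_I_von_neumann_algebra ::
    "('h, 'm) hilbert_scheme \<Rightarrow> ('h \<Rightarrow> 'h) set \<Rightarrow> bool" where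
  "type_I_von_neumann_algebra H M \<longleftrightarrow> von_neumann_algebra H M \<and>
     (\<forall>Z. central_projection H M Z \<and> Z \<noteq> zero_operator H \<longrightarrow>
       (\<exists>E. abelian_projection H M E \<and> E \<noteq> zero_operator H \<and> projection_le H E Z))"


section \<open>Unitary representations and type I groups\<close>

definition unitary_group :: "('h, 'm) hilbert_scheme \<Rightarrow> ('h \<Rightarrow> 'h) monoid" where
  "unitary_group H =
     \<lparr>carrier = {U \<in> bounded_operators H. U ` carrier H = carrier H \<and>
        (\<forall>v\<in>carrier H. \<forall>w\<in>carrier H. cinner H (U v) (U w) = cinner H v w)},
      mult = compose (carrier H),
      one = (\<lambda>v\<in>carrier H. v)\<rparr>"

text \<open>As usual for topological groups, unitary representations are strongly continuous.\<close>

definition unitary_representation ::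
    "('g, 'n) monoid_scheme \<Rightarrow> 'g topology \<Rightarrow> ('h, 'm) hilbert_scheme \<Rightarrow> ('g \<Rightarrow> 'h \<Rightarrow> 'h) \<Rightarrow> bool"
where
  "unitary_representation G T H \<pi> \<longleftrightarrow> \<pi> \<in> hom G (unitary_group H) \<and>
     (\<forall>v\<in>carrier H. continuous_map T (norm_topology H) (\<lambda>g. \<pi> g v))"

text \<open>
  HOL cannot quantify over all types, so the Hilbert spaces in the definition of type I are those
  whose underlying set is contained in a given type \<open>'h\<close>. Negated statements get stronger
  as \<open>'h\<close> gets smaller. The type \<^typ>\<open>nat \<Rightarrow> complex\<close> contains a copy of every separable
  complex Hilbert space, and for a second countable locally compact group separable
  Hilbert spaces suffice to detect failure of type I.
\<close>

definition type_I_group ::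
    "'h itself \<Rightarrow> ('g, 'n) monoid_scheme \<Rightarrow> 'g topology \<Rightarrow> bool" where
  "type_I_group _ G T \<longleftrightarrow>
     (\<forall>(H :: 'h hilbert) \<pi>. hilbert_space H \<and> unitary_representation G T H \<pi> \<longrightarrow>
       type_I_von_neumann_algebra H (generated_von_neumann_algebra H (\<pi> ` carrier G)))"


section \<open>The cocycles and the central extensions\<close>

definition theta :: "nat \<Rightarrow> 'a::comm_ring_1 fls \<Rightarrow> 'a fls \<Rightarrow> 'a fls" where
  "theta n x y = Abs_fls (\<lambda>i. fls_nth x i * fls_nth y (i + int n))"

text \<open>
  The topology on \<^typ>\<open>'a fls\<close> is the library's \<open>t\<close>-adic one. The series is indexed from
  \<open>1\<close>, hence the shift by \<^const>\<open>Suc\<close>; the value \<open>s 0\<close> is irrelevant.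
\<close>

definition eta :: "(nat \<Rightarrow> nat) \<Rightarrow> 'a::comm_ring_1 fls \<Rightarrow> 'a fls \<Rightarrow> 'a fls" where
  "eta s x y = (\<Sum>n. of_nat (s (Suc n)) * fls_X ^ Suc n * theta (2 * Suc n) x y)"

text \<open>The identity is \<open>(0, 0)\<close> because the cocycle is normalised (here even bi-additive).\<close>

definition central_extension ::
    "('b \<Rightarrow> 'b \<Rightarrow> 'a) \<Rightarrow> ('a::ab_group_add \<times> 'b::ab_group_add) monoid" where
  "central_extension \<eta> =
     \<lparr>carrier = UNIV,
      mult = (\<lambda>(w, x) (y, z). (w + y + \<eta> x z, x + z)),
      one = (0, 0)\<rparr>"


lemma fls_nth_theta [simp]:
  "fls_nth (theta n x y) i = fls_nth x i * fls_nth y (i + int n)"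
  unfolding theta_def
  by (subst nth_Abs_fls_lower_bound[of "fls_subdegree x"]) auto

lemma eta_sums:
  "(\<lambda>n. of_nat (s (Suc n)) * fls_X ^ Suc n * theta (2 * Suc n) x y) sums
     Abs_fls (\<lambda>k. \<Sum>n = 1..nat (k - fls_subdegree x).
       of_nat (s n) * (fls_nth x (k - int n) * fls_nth y (k + int n)))"
  (is "?g sums Abs_fls ?f")
proof -
  define d where "d = fls_subdegree x"
  have F: "fls_nth (Abs_fls ?f) k = ?f k" for k
    by (subst nth_Abs_fls_lower_bound[of d]) (auto simp: d_def)
  have g: "fls_nth (?g n) k =
      of_nat (s (Suc n)) * (fls_nth x (k - int (Suc n)) * fls_nth y (k + int (Suc n)))" for n k
  proof -
    have "fls_nth (?g n) k =
        of_nat (s (Suc n)) * fls_nth (theta (2 * Suc n) x y) (k - int (Suc n))"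
      unfolding mult.assoc fls_X_power_times_conv_shift(1) fls_mult_of_nat_nth(1) fls_shift_nth
      by (simp only: add_uminus_conv_diff)
    moreover have "k - int (Suc n) + int (2 * Suc n) = k + int (Suc n)" by simp
    ultimately show ?thesis by (simp only: fls_nth_theta)
  qed
  have gs: "fls_nth (\<Sum>n<N. ?g n) k =
      (\<Sum>n = 1..N. of_nat (s n) * (fls_nth x (k - int n) * fls_nth y (k + int n)))" for N k
  proof -
    have "fls_nth (\<Sum>n<N. ?g n) k = (\<Sum>n<N. fls_nth (?g n) k)"
      by (simp only: fls_nth_sum)
    also have "\<dots> = (\<Sum>n = 1..N. of_nat (s n) * (fls_nth x (k - int n) * fls_nth y (k + int n)))"
      unfolding g by (rule sum.reindex_bij_witness[of _ "\<lambda>n. n - 1" Suc]) auto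
    finally show ?thesis .
  qed
  have eq: "fls_nth (\<Sum>n<N. ?g n) k = fls_nth (Abs_fls ?f) k" if "k \<le> int N + d" for N k
    unfolding gs F
    by (rule sum.mono_neutral_right) (use that in \<open>auto simp: d_def\<close>)
  have dist: "dist (\<Sum>n<N. ?g n) (Abs_fls ?f) \<le> (1 / 2) ^ (N - nat (- d))"
    if "N \<ge> nat (- d)" for N
  proof (cases "(\<Sum>n<N. ?g n) = Abs_fls ?f")
    case False
    have "int N + d \<le> fls_subdegree ((\<Sum>n<N. ?g n) - Abs_fls ?f)"
      by (rule fls_subdegree_geI) (use False eq in auto)
    moreover have "int (N - nat (- d)) \<le> int N + d" using that by linarith
    ultimately have "int (N - nat (- d)) \<le> fls_subdegree ((\<Sum>n<N. ?g n) - Abs_fls ?f)"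
      by linarith
    then show ?thesis
      using False by (auto simp: dist_fls_def power_one_over inverse_eq_divide
          intro!: divide_left_mono power_increasing)
  qed simp
  have "(\<lambda>N. (1 / 2 :: real) ^ (N - nat (- d))) \<longlonglongrightarrow> 0"
    by (rule LIMSEQ_offset[where k = "nat (- d)"]) (simp add: LIMSEQ_power_zero)
  moreover have "\<forall>\<^sub>F N in sequentially.
      norm (dist (\<Sum>n<N. ?g n) (Abs_fls ?f)) \<le> (1 / 2) ^ (N - nat (- d))"
    unfolding eventually_sequentially real_norm_def abs_of_nonneg[OF zero_le_dist]
    using dist by blast
  ultimately show ?thesis
    unfolding sums_def tendsto_dist_iff[of _ "Abs_fls ?f"] by (rule Lim_null_comparison[rotated])
qed

lemma fls_nth_eta:
  assumes "k - fls_subdegree x \<le> int N"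
  shows "fls_nth (eta s x y) k =
    (\<Sum>n = 1..N. of_nat (s n) * (fls_nth x (k - int n) * fls_nth y (k + int n)))"
proof -
  have "eta s x y = Abs_fls (\<lambda>k. \<Sum>n = 1..nat (k - fls_subdegree x).
       of_nat (s n) * (fls_nth x (k - int n) * fls_nth y (k + int n)))" (is "_ = Abs_fls ?f")
    unfolding eta_def using eta_sums by (rule sums_unique[symmetric])
  then have "fls_nth (eta s x y) k = ?f k"
    by (simp add: nth_Abs_fls_lower_bound[of "fls_subdegree x"])
  also have "\<dots> = (\<Sum>n = 1..N. of_nat (s n) * (fls_nth x (k - int n) * fls_nth y (k + int n)))"
    by (rule sum.mono_neutral_left) (use assms in auto)
  finally show ?thesis .
qed

lemma eta_add_left: "eta s (x + x') y = eta s x y + eta s x' y"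
proof (rule fls_eqI)
  fix k
  define N where
    "N = nat (max (k - fls_subdegree (x + x')) (max (k - fls_subdegree x) (k - fls_subdegree x')))"
  have le: "k - fls_subdegree (x + x') \<le> int N" "k - fls_subdegree x \<le> int N"
      "k - fls_subdegree x' \<le> int N"
    by (auto simp: N_def)
  show "fls_nth (eta s (x + x') y) k = fls_nth (eta s x y + eta s x' y) k"
    by (simp add: fls_nth_eta[OF le(1)] fls_nth_eta[OF le(2)] fls_nth_eta[OF le(3)]
        algebra_simps sum.distrib)
qed

lemma eta_add_right: "eta s x (y + y') = eta s x y + eta s x y'"
proof (rule fls_eqI)
  fix k
  define N where "N = nat (k - fls_subdegree x)"
  show "fls_nth (eta s x (y + y')) k = fls_nth (eta s x y + eta s x y') k"
    by (simp add: fls_nth_eta[where N = N] N_def algebra_simps sum.distrib)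
qed

lemma group_central_extension_eta: "group (central_extension (eta s))"
proof (rule groupI)
  have [simp]: "eta s 0 y = 0" for y using eta_add_left[of s 0 0 y] by simp
  have [simp]: "eta s x 0 = 0" for x using eta_add_right[of s x 0 0] by simp
  have neg: "eta s (- x) x = - eta s x x" for x
    using eta_add_left[of s x "- x" x] by (simp add: eq_neg_iff_add_eq_0 add.commute)
  show "\<one>\<^bsub>central_extension (eta s)\<^esub> \<otimes>\<^bsub>central_extension (eta s)\<^esub> g = g" for g
    by (cases g) (simp add: central_extension_def)
  show "\<exists>h\<in>carrier (central_extension (eta s)).
      h \<otimes>\<^bsub>central_extension (eta s)\<^esub> g = \<one>\<^bsub>central_extension (eta s)\<^esub>" for g
    by (cases g, rule bexI[of _ "(eta s (snd g) (snd g) - fst g, - snd g)"])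
      (simp_all add: central_extension_def neg)
qed (auto simp: central_extension_def eta_add_left eta_add_right algebra_simps)

end

theory Submission
  imports Defs
begin

text \<open>
  Let \<open>N\<close> bound the support of \<open>s\<close>, and let \<open>\<psi> w = exp (2 \<pi> i / p * (\<Sum>k<-N. w\<^sub>k))\<close>, a character of
  the central subgroup. The bicharacter \<open>b x y = \<psi> (\<eta>\<^sub>s x y)\<close> only sees the coefficients of \<open>x\<close> and
  \<open>y\<close> of negative index, so it lives on the countable discrete group of principal parts, and the
  left regular representation \<open>\<lambda>\<close> of that group twisted by \<open>b\<close> gives a unitary representation of
  the extension. Since \<open>b\<close> only couples coefficients whose indices are at most \<open>2 N\<close> apart, for
  \<open>s n = 1\<close> and large \<open>L\<close> the monomials \<open>u = t\<^bsup>-L-n\<^esup>\<close> and \<open>v = t\<^bsup>-L+n\<^esup>\<close> satisfy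
  \<open>b u v = \<zeta> * b v u\<close> with a fixed \<open>\<zeta> \<noteq> 1\<close>, although both become central with respect to any given
  finite set. As the commutant contains the right regular representation \<open>\<rho>\<close>, a projection \<open>E\<close> of
  the generated algebra is determined by \<open>\<xi> = E \<delta>\<^sub>0\<close>. If \<open>E\<close> is abelian then, up to arbitrarily small
  errors, \<open>\<rho>\<^sub>v \<rho>\<^sub>u \<xi> = E \<lambda>\<^sub>u E \<lambda>\<^sub>v \<xi> = E \<lambda>\<^sub>v E \<lambda>\<^sub>u \<xi> = \<rho>\<^sub>u \<rho>\<^sub>v \<xi>\<close>, whereas \<open>\<rho>\<^sub>v \<rho>\<^sub>u = \<zeta> \<rho>\<^sub>u \<rho>\<^sub>v\<close>.
  Hence \<open>\<xi> = 0\<close> and \<open>E = 0\<close>.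
\<close>

section \<open>The Hilbert space of square-summable functions\<close>

definition ell2 :: "('i \<Rightarrow> complex) hilbert" where
  "ell2 = \<lparr>carrier = {f. (\<lambda>i. (cmod (f i))\<^sup>2) summable_on UNIV},
     mult = (\<lambda>f g i. f i * g i), one = (\<lambda>_. 1), zero = (\<lambda>_. 0), add = (\<lambda>f g i. f i + g i),
     smult = (\<lambda>c f i. c * f i), cinner = (\<lambda>f g. \<Sum>\<^sub>\<infinity>i. f i * cnj (g i))\<rparr>"

lemma ell2_simps [simp]:
  "\<zero>\<^bsub>ell2\<^esub> = (\<lambda>_. 0)" "f \<oplus>\<^bsub>ell2\<^esub> g = (\<lambda>i. f i + g i)" "c \<odot>\<^bsub>ell2\<^esub> f = (\<lambda>i. c * f i)"
  "cinner ell2 f g = (\<Sum>\<^sub>\<infinity>i. f i * cnj (g i))"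
  by (simp_all add: ell2_def)

lemma mem_ell2: "f \<in> carrier ell2 \<longleftrightarrow> (\<lambda>i. (cmod (f i))\<^sup>2) summable_on UNIV"
  by (simp add: ell2_def)

lemma cinner_ell2_self:
  assumes "f \<in> carrier ell2"
  shows "cinner ell2 f f = of_real (\<Sum>\<^sub>\<infinity>i. (cmod (f i))\<^sup>2)"
proof -
  have "((\<lambda>i. of_real ((cmod (f i))\<^sup>2) :: complex) has_sum of_real (\<Sum>\<^sub>\<infinity>i. (cmod (f i))\<^sup>2)) UNIV"
    using assms by (intro has_sum_of_real) (simp add: mem_ell2)
  then show ?thesis
    unfolding ell2_simps complex_norm_square by (rule infsumI)
qed

lemma hnorm_ell2: "f \<in> carrier ell2 \<Longrightarrow> hnorm ell2 f = sqrt (\<Sum>\<^sub>\<infinity>i. (cmod (f i))\<^sup>2)"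
  unfolding hnorm_def by (subst cinner_ell2_self) auto

lemma hnorm_ell2_nonneg [simp]: "f \<in> carrier ell2 \<Longrightarrow> 0 \<le> hnorm ell2 f"
  by (simp add: hnorm_ell2 infsum_nonneg)

lemma hnorm_ell2_sq: "f \<in> carrier ell2 \<Longrightarrow> cinner ell2 f f = of_real ((hnorm ell2 f)\<^sup>2)"
  by (subst cinner_ell2_self) (auto simp: hnorm_ell2 infsum_nonneg)

lemma L2_set_le_hnorm_ell2:
  assumes "f \<in> carrier ell2"
  shows "L2_set (\<lambda>i. cmod (f i)) F \<le> hnorm ell2 f"
proof (cases "finite F")
  case True
  then show ?thesis
    using assms unfolding hnorm_ell2[OF assms] L2_set_def
    by (intro real_sqrt_le_mono finite_sum_le_infsum) (auto simp: mem_ell2)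
qed (use assms in simp)

text \<open>An infinite sum of nonnegative terms is the supremum of its finite partial sums.
  Inequalities for \<open>L2_set\<close> on finite index sets thereby carry over to
  \<open>ell2\<close>.\<close>

lemma ell2I:
  assumes "\<And>F. finite F \<Longrightarrow> L2_set (\<lambda>i. cmod (f i)) F \<le> C"
  shows "f \<in> carrier ell2" and "hnorm ell2 f \<le> C"
proof -
  have C: "0 \<le> C" using assms[of "{}"] by simp
  have le: "(\<Sum>i\<in>F. (cmod (f i))\<^sup>2) \<le> C\<^sup>2" if "finite F" for F
    using assms[OF that] unfolding L2_set_def by (rule sqrt_le_D)
  show f: "f \<in> carrier ell2"
    unfolding mem_ell2
    by (rule nonneg_bdd_above_summable_on) (auto intro!: bdd_aboveI2 le)
  show "hnorm ell2 f \<le> C"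
    unfolding hnorm_ell2[OF f] using f C
    by (intro real_le_lsqrt infsum_le_finite_sums le) (auto simp: mem_ell2)
qed

lemma cmod_le_hnorm_ell2: "f \<in> carrier ell2 \<Longrightarrow> cmod (f i) \<le> hnorm ell2 f"
  using L2_set_le_hnorm_ell2[of f "{i}"] by simp

lemma hnorm_ell2_eq_0: "f \<in> carrier ell2 \<Longrightarrow> hnorm ell2 f = 0 \<Longrightarrow> f = (\<lambda>_. 0)"
  using cmod_le_hnorm_ell2[of f] by fastforce

lemma zero_ell2 [simp]: "(\<lambda>_. 0) \<in> carrier ell2" "hnorm ell2 (\<lambda>_. 0) = 0"
  by (simp_all add: mem_ell2 hnorm_def)

lemma ell2_add:
  assumes "f \<in> carrier ell2" "g \<in> carrier ell2"
  shows "(\<lambda>i. f i + g i) \<in> carrier ell2"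
    and "hnorm ell2 (\<lambda>i. f i + g i) \<le> hnorm ell2 f + hnorm ell2 g"
proof -
  have "L2_set (\<lambda>i. cmod (f i + g i)) F \<le> hnorm ell2 f + hnorm ell2 g" for F
  proof -
    have "L2_set (\<lambda>i. cmod (f i + g i)) F \<le> L2_set (\<lambda>i. cmod (f i) + cmod (g i)) F"
      by (intro L2_set_mono norm_triangle_ineq norm_ge_zero)
    also have "\<dots> \<le> L2_set (\<lambda>i. cmod (f i)) F + L2_set (\<lambda>i. cmod (g i)) F"
      by (rule L2_set_triangle_ineq)
    also have "\<dots> \<le> hnorm ell2 f + hnorm ell2 g"
      by (intro add_mono L2_set_le_hnorm_ell2 assms)
    finally show ?thesis .
  qed
  then show "(\<lambda>i. f i + g i) \<in> carrier ell2"
    "hnorm ell2 (\<lambda>i. f i + g i) \<le> hnorm ell2 f + hnorm ell2 g"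
    by (rule ell2I)+
qed

lemma ell2_smult:
  assumes "f \<in> carrier ell2"
  shows "(\<lambda>i. c * f i) \<in> carrier ell2" and "hnorm ell2 (\<lambda>i. c * f i) = cmod c * hnorm ell2 f"
proof -
  show c: "(\<lambda>i. c * f i) \<in> carrier ell2"
    using assms by (simp add: mem_ell2 norm_mult power_mult_distrib summable_on_cmult_right)
  show "hnorm ell2 (\<lambda>i. c * f i) = cmod c * hnorm ell2 f"
    unfolding hnorm_ell2[OF c] hnorm_ell2[OF assms]
    by (simp add: norm_mult power_mult_distrib infsum_cmult_right' real_sqrt_mult)
qed

lemma ell2_diff:
  assumes "f \<in> carrier ell2" "g \<in> carrier ell2"
  shows "(\<lambda>i. f i - g i) \<in> carrier ell2"
    and "hnorm ell2 (\<lambda>i. f i - g i) \<le> hnorm ell2 f + hnorm ell2 g"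
  using ell2_add[OF assms(1) ell2_smult(1)[OF assms(2), of "-1"]] ell2_smult(2)[OF assms(2), of "-1"]
  by simp_all

lemma hnorm_ell2_minus_commute:
  assumes "f \<in> carrier ell2" "g \<in> carrier ell2"
  shows "hnorm ell2 (\<lambda>i. f i - g i) = hnorm ell2 (\<lambda>i. g i - f i)"
  using ell2_smult(2)[OF ell2_diff(1)[OF assms], of "-1"] by simp

lemma hnorm_ell2_diff_triangle:
  assumes "f \<in> carrier ell2" "g \<in> carrier ell2" "h \<in> carrier ell2"
  shows "hnorm ell2 (\<lambda>i. f i - h i) \<le> hnorm ell2 (\<lambda>i. f i - g i) + hnorm ell2 (\<lambda>i. g i - h i)"
  using ell2_add(2)[OF ell2_diff(1)[OF assms(1,2)] ell2_diff(1)[OF assms(2,3)]] by simp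

text \<open>Cauchy-Schwarz on finite sets bounds the sums of absolute values uniformly, which yields
  absolute summability and, in the limit, the inequality itself.\<close>

lemma cinner_ell2:
  assumes "f \<in> carrier ell2" "g \<in> carrier ell2"
  shows cinner_ell2_summable: "(\<lambda>i. f i * cnj (g i)) summable_on UNIV"
    and cinner_ell2_le: "cmod (cinner ell2 f g) \<le> hnorm ell2 f * hnorm ell2 g"
proof -
  have le: "(\<Sum>i\<in>F. cmod (f i * cnj (g i))) \<le> hnorm ell2 f * hnorm ell2 g" for F
  proof -
    have "(\<Sum>i\<in>F. cmod (f i * cnj (g i))) \<le> L2_set (\<lambda>i. cmod (f i)) F * L2_set (\<lambda>i. cmod (g i)) F"
      using L2_set_mult_ineq[of "\<lambda>i. cmod (f i)" "\<lambda>i. cmod (g i)" F] by (simp add: norm_mult)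
    also have "\<dots> \<le> hnorm ell2 f * hnorm ell2 g"
      by (intro mult_mono L2_set_le_hnorm_ell2 assms) (auto simp: assms)
    finally show ?thesis .
  qed
  have abs: "(\<lambda>i. cmod (f i * cnj (g i))) summable_on UNIV"
    unfolding abs_summable_iff_bdd_above by (rule bdd_aboveI2) (rule le)
  then show "(\<lambda>i. f i * cnj (g i)) summable_on UNIV"
    by (rule abs_summable_summable)
  have "cmod (cinner ell2 f g) \<le> (\<Sum>\<^sub>\<infinity>i. cmod (f i * cnj (g i)))"
    unfolding ell2_simps using abs by (rule norm_infsum_bound)
  also have "\<dots> \<le> hnorm ell2 f * hnorm ell2 g"
    using abs le by (rule infsum_le_finite_sums)
  finally show "cmod (cinner ell2 f g) \<le> hnorm ell2 f * hnorm ell2 g" .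
qed

section \<open>Hilbert space axioms and completeness of \<open>ell2\<close>\<close>

lemma cring_complex_ring: "cring complex_ring"
proof (rule cringI)
  show "abelian_group complex_ring"
  proof (rule abelian_groupI)
    fix x :: complex
    show "\<exists>y\<in>carrier complex_ring. y \<oplus>\<^bsub>complex_ring\<^esub> x = \<zero>\<^bsub>complex_ring\<^esub>"
      by (rule bexI[of _ "- x"]) (auto simp: complex_ring_def)
  qed (auto simp: complex_ring_def)
  show "comm_monoid complex_ring"
    by (rule comm_monoidI) (auto simp: complex_ring_def)
qed (auto simp: complex_ring_def algebra_simps)

lemma module_ell2: "Module.module complex_ring (ell2 :: ('a \<Rightarrow> complex) hilbert)"
proof (rule moduleI)
  show "abelian_group (ell2 :: ('a \<Rightarrow> complex) hilbert)"
  proof (rule abelian_groupI)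
    fix f :: "'a \<Rightarrow> complex" assume "f \<in> carrier ell2"
    then show "\<exists>g\<in>carrier ell2. g \<oplus>\<^bsub>ell2\<^esub> f = \<zero>\<^bsub>ell2\<^esub>"
      using ell2_smult(1)[of f "-1"] by (intro bexI[of _ "\<lambda>i. -1 * f i"]) auto
  qed (auto simp: ell2_add algebra_simps)
qed (use cring_complex_ring in \<open>auto simp: ell2_smult complex_ring_def algebra_simps\<close>)

lemma ell2_minus:
  assumes "f \<in> carrier ell2" "g \<in> carrier ell2"
  shows "f \<ominus>\<^bsub>ell2\<^esub> g = (\<lambda>i. f i - g i)"
proof -
  interpret Module.module complex_ring "ell2 :: ('a \<Rightarrow> complex) hilbert" by (rule module_ell2)
  have "\<ominus>\<^bsub>ell2\<^esub> g = (\<lambda>i. - 1 * g i)"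
    by (rule minus_equality) (use assms ell2_smult(1)[of g "-1"] in auto)
  then show ?thesis by (simp add: a_minus_def)
qed

lemma hdist_ell2:
  assumes "f \<in> carrier ell2" "g \<in> carrier ell2"
  shows "hdist ell2 f g = hnorm ell2 (\<lambda>i. f i - g i)"
  using assms by (simp add: hdist_def ell2_minus)

lemma Metric_space_ell2: "Metric_space (carrier ell2) (hdist ell2)"
proof
  fix f g h :: "'a \<Rightarrow> complex"
  show "0 \<le> hdist ell2 f g"
    by (cases "f \<in> carrier ell2 \<and> g \<in> carrier ell2")
      (auto simp: hdist_ell2 ell2_diff, auto simp: hdist_def)
  show "hdist ell2 f g = hdist ell2 g f"
  proof (cases "f \<in> carrier ell2 \<and> g \<in> carrier ell2")
    case True
    then show ?thesis using hnorm_ell2_minus_commute[of f g] by (simp add: hdist_ell2)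
  qed (auto simp: hdist_def)
  assume f: "f \<in> carrier ell2" and g: "g \<in> carrier ell2"
  show "hdist ell2 f g = 0 \<longleftrightarrow> f = g"
  proof
    assume "hdist ell2 f g = 0"
    then have "(\<lambda>i. f i - g i) = (\<lambda>_. 0)"
      using f g by (intro hnorm_ell2_eq_0 ell2_diff) (auto simp: hdist_ell2)
    then show "f = g" by (simp add: fun_eq_iff)
  qed (use f in \<open>simp add: hdist_ell2\<close>)
  assume "h \<in> carrier ell2"
  with f g show "hdist ell2 f h \<le> hdist ell2 f g + hdist ell2 g h"
    by (simp add: hdist_ell2 hnorm_ell2_diff_triangle)
qed

lemma mcomplete_ell2: "Metric_space.mcomplete (carrier ell2) (hdist ell2)"
proof -
  interpret M: Metric_space "carrier ell2" "hdist (ell2 :: ('a \<Rightarrow> complex) hilbert)"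
    by (rule Metric_space_ell2)
  have "\<exists>g. limitin M.mtopology \<sigma> g sequentially" if "M.MCauchy \<sigma>" for \<sigma> :: "nat \<Rightarrow> 'a \<Rightarrow> complex"
  proof -
    have \<sigma>: "\<sigma> n \<in> carrier ell2" for n
      using that by (auto simp: M.MCauchy_def)
    have Cauchy: "\<exists>N. \<forall>n\<ge>N. \<forall>m\<ge>N. hnorm ell2 (\<lambda>i. \<sigma> n i - \<sigma> m i) < \<epsilon>"
      if \<epsilon>: "\<epsilon> > 0" for \<epsilon>
    proof -
      obtain N where "\<forall>n m. N \<le> n \<longrightarrow> N \<le> m \<longrightarrow> hdist ell2 (\<sigma> n) (\<sigma> m) < \<epsilon>"
        using \<open>M.MCauchy \<sigma>\<close> \<epsilon> unfolding M.MCauchy_def by meson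
      then show ?thesis
        by (intro exI[of _ N]) (simp add: hdist_ell2 \<sigma>)
    qed
    have "Cauchy (\<lambda>n. \<sigma> n i)" for i
    proof (rule metric_CauchyI)
      fix \<epsilon> :: real assume "\<epsilon> > 0"
      from Cauchy[OF this] obtain N where
        N: "\<And>n m. n \<ge> N \<Longrightarrow> m \<ge> N \<Longrightarrow> hnorm ell2 (\<lambda>i. \<sigma> n i - \<sigma> m i) < \<epsilon>" by blast
      have "dist (\<sigma> m i) (\<sigma> n i) < \<epsilon>" if "m \<ge> N" "n \<ge> N" for m n
        using cmod_le_hnorm_ell2[OF ell2_diff(1)[OF \<sigma>[of m] \<sigma>[of n]], of i] N[OF that]
        by (simp add: dist_norm)
      then show "\<exists>N. \<forall>m\<ge>N. \<forall>n\<ge>N. dist (\<sigma> m i) (\<sigma> n i) < \<epsilon>" by blast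
    qed
    then have "\<exists>l. (\<lambda>n. \<sigma> n i) \<longlonglongrightarrow> l" for i
      by (simp add: Cauchy_convergent_iff convergent_def)
    then obtain g where g: "\<And>i. (\<lambda>n. \<sigma> n i) \<longlonglongrightarrow> g i" by metis
    \<comment> \<open>For a fixed finite set \<open>F\<close> the limit in \<open>m\<close> can be
      taken inside the Cauchy estimate. Since \<open>N\<close> does not depend on \<open>F\<close>,
      \<open>ell2I\<close> upgrades pointwise convergence to convergence in norm.\<close>
    have lim: "\<exists>N. \<forall>n\<ge>N. (\<lambda>i. \<sigma> n i - g i) \<in> carrier ell2 \<and> hnorm ell2 (\<lambda>i. \<sigma> n i - g i) \<le> \<epsilon>"
      if "\<epsilon> > 0" for \<epsilon>
    proof -
      from Cauchy[OF that] obtain N where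
        N: "\<And>n m. n \<ge> N \<Longrightarrow> m \<ge> N \<Longrightarrow> hnorm ell2 (\<lambda>i. \<sigma> n i - \<sigma> m i) < \<epsilon>" by blast
      have "L2_set (\<lambda>i. cmod (\<sigma> n i - g i)) F \<le> \<epsilon>" if n: "n \<ge> N" for n F
      proof (rule tendsto_upperbound)
        show "(\<lambda>m. L2_set (\<lambda>i. cmod (\<sigma> n i - \<sigma> m i)) F) \<longlonglongrightarrow> L2_set (\<lambda>i. cmod (\<sigma> n i - g i)) F"
          unfolding L2_set_def by (intro tendsto_intros g)
        show "\<forall>\<^sub>F m in sequentially. L2_set (\<lambda>i. cmod (\<sigma> n i - \<sigma> m i)) F \<le> \<epsilon>"
          using eventually_ge_at_top[of N]
        proof eventually_elim
          case (elim m)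
          show ?case
            using L2_set_le_hnorm_ell2[OF ell2_diff(1)[OF \<sigma>[of n] \<sigma>[of m]], of F] N[OF n elim] by simp
        qed
      qed simp
      then show ?thesis by (intro exI[of _ N] allI impI conjI ell2I)
    qed
    from lim[of 1] obtain N where "(\<lambda>i. \<sigma> N i - g i) \<in> carrier ell2" by auto
    from ell2_diff(1)[OF \<sigma>[of N] this] have g': "g \<in> carrier ell2" by simp
    have "limitin M.mtopology \<sigma> g sequentially"
      unfolding M.limit_metric_sequentially
    proof (intro conjI allI impI g')
      fix \<epsilon> :: real assume "\<epsilon> > 0"
      with lim[of "\<epsilon> / 2"] obtain N where "\<forall>n\<ge>N. hnorm ell2 (\<lambda>i. \<sigma> n i - g i) \<le> \<epsilon> / 2" by auto
      with \<open>\<epsilon> > 0\<close> show "\<exists>N. \<forall>n\<ge>N. \<sigma> n \<in> carrier ell2 \<and> hdist ell2 (\<sigma> n) g < \<epsilon>"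
        by (intro exI[of _ N]) (fastforce simp: \<sigma> g' hdist_ell2)
    qed
    then show ?thesis by blast
  qed
  then show ?thesis by (simp add: M.mcomplete_def)
qed

lemma cinner_ell2_add_left:
  assumes "f \<in> carrier ell2" "g \<in> carrier ell2" "h \<in> carrier ell2"
  shows "cinner ell2 (\<lambda>i. f i + g i) h = cinner ell2 f h + cinner ell2 g h"
  using infsum_add[OF cinner_ell2_summable[OF assms(1,3)] cinner_ell2_summable[OF assms(2,3)]]
  by (simp add: distrib_right)

lemma cinner_ell2_smult_left: "cinner ell2 (\<lambda>i. c * f i) g = c * cinner ell2 f g"
  by (simp add: mult.assoc infsum_cmult_right')

lemma cinner_ell2_commute: "cinner ell2 g f = cnj (cinner ell2 f g)"
  by (simp add: mult.commute flip: infsum_cnj)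

theorem hilbert_space_ell2: "hilbert_space ell2"
proof -
  interpret Module.module complex_ring "ell2 :: ('a \<Rightarrow> complex) hilbert" by (rule module_ell2)
  show ?thesis
  proof
    fix f :: "'a \<Rightarrow> complex" assume f: "f \<in> carrier ell2" "f \<noteq> \<zero>\<^bsub>ell2\<^esub>"
    with hnorm_ell2_eq_0[OF f(1)] have "hnorm ell2 f \<noteq> 0" by auto
    with hnorm_ell2_sq[OF f(1)] show "Re (cinner ell2 f f) > 0" by simp
  next
    show "cinner ell2 (f \<oplus>\<^bsub>ell2\<^esub> g) h = cinner ell2 f h + cinner ell2 g h"
      if "f \<in> carrier ell2" "g \<in> carrier ell2" "h \<in> carrier ell2" for f g h :: "'a \<Rightarrow> complex"
      using cinner_ell2_add_left[OF that] by simp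
    show "cinner ell2 (c \<odot>\<^bsub>ell2\<^esub> f) g = c * cinner ell2 f g" for c and f g :: "'a \<Rightarrow> complex"
      using cinner_ell2_smult_left[of c f g] by simp
  qed (rule cinner_ell2_commute mcomplete_ell2)+
qed

section \<open>Bounded operators and commutants\<close>

lemma bounded_operators_ell2D:
  assumes "A \<in> bounded_operators ell2"
  shows bounded_operator_ell2_closed: "f \<in> carrier ell2 \<Longrightarrow> A f \<in> carrier ell2"
    and bounded_operator_ell2_add: "\<lbrakk>f \<in> carrier ell2; g \<in> carrier ell2\<rbrakk> \<Longrightarrow>
      A (\<lambda>i. f i + g i) = (\<lambda>i. A f i + A g i)"
    and bounded_operator_ell2_smult: "f \<in> carrier ell2 \<Longrightarrow> A (\<lambda>i. c * f i) = (\<lambda>i. c * A f i)"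
  using assms by (auto simp: bounded_operators_def)

lemma bounded_operator_ell2_diff:
  assumes "A \<in> bounded_operators ell2" "f \<in> carrier ell2" "g \<in> carrier ell2"
  shows "A (\<lambda>i. f i - g i) = (\<lambda>i. A f i - A g i)"
  using bounded_operator_ell2_add[OF assms(1,2) ell2_smult(1)[OF assms(3), of "-1"]]
    bounded_operator_ell2_smult[OF assms(1,3), of "-1"]
  by simp

lemma bounded_operator_ell2_zero:
  assumes "A \<in> bounded_operators ell2"
  shows "A (\<lambda>_. 0) = (\<lambda>_. 0)"
  using bounded_operator_ell2_smult[OF assms zero_ell2(1), of 0] by simp

lemma bounded_operator_ell2_bound:
  assumes "A \<in> bounded_operators ell2"
  obtains K where "K \<ge> 0" "\<And>f. f \<in> carrier ell2 \<Longrightarrow> hnorm ell2 (A f) \<le> K * hnorm ell2 f"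
proof -
  obtain K where K: "\<And>f. f \<in> carrier ell2 \<Longrightarrow> hnorm ell2 (A f) \<le> K * hnorm ell2 f"
    using assms unfolding bounded_operators_def by blast
  show thesis
  proof (rule that[of "\<bar>K\<bar>"])
    show "hnorm ell2 (A f) \<le> \<bar>K\<bar> * hnorm ell2 f" if "f \<in> carrier ell2" for f
      using K[OF that] mult_right_mono[OF abs_ge_self[of K] hnorm_ell2_nonneg[OF that]] by linarith
  qed simp
qed

lemma mem_commutant:
  assumes "S \<subseteq> bounded_operators H"
  shows "B \<in> commutant H S \<longleftrightarrow>
    B \<in> bounded_operators H \<and> (\<forall>A\<in>S. \<forall>v\<in>carrier H. A (B v) = B (A v))"
  by (auto simp: commutant_def compose_def fun_eq_iff restrict_def)

lemma commutant_subset: "commutant H S \<subseteq> bounded_operators H"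
  by (auto simp: commutant_def)

lemma subset_double_commutant:
  "S \<subseteq> bounded_operators H \<Longrightarrow> S \<subseteq> commutant H (commutant H S)"
  by (auto simp: commutant_def)

text \<open>Taking commutants reverses inclusions. Applied to the inclusion of \<open>S\<close> in
  its double commutant this gives one half; the other half is that inclusion for
  \<open>commutant H S\<close>.\<close>

lemma triple_commutant:
  assumes "S \<subseteq> bounded_operators H"
  shows "commutant H (commutant H (commutant H S)) = commutant H S"
proof
  show "commutant H (commutant H (commutant H S)) \<subseteq> commutant H S"
    using subset_double_commutant[OF assms] unfolding commutant_def by blast
  show "commutant H S \<subseteq> commutant H (commutant H (commutant H S))"
    by (rule subset_double_commutant[OF commutant_subset])
qed

section \<open>Finitely supported vectors and existence of adjoints\<close>

definition ell2_unit :: "'i \<Rightarrow> 'i \<Rightarrow> complex" where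
  "ell2_unit j = (\<lambda>i. if i = j then 1 else 0)"

lemma ell2_finite_support:
  assumes "finite F"
  shows "(\<lambda>i. if i \<in> F then f i else 0) \<in> carrier ell2"
    and "hnorm ell2 (\<lambda>i. if i \<in> F then f i else 0) \<le> L2_set (\<lambda>i. cmod (f i)) F"
proof -
  have le: "L2_set (\<lambda>i. cmod (if i \<in> F then f i else 0)) G \<le> L2_set (\<lambda>i. cmod (f i)) F"
    if "finite G" for G
  proof -
    have "(\<Sum>i\<in>G. (cmod (if i \<in> F then f i else 0))\<^sup>2) = (\<Sum>i\<in>G \<inter> F. (cmod (f i))\<^sup>2)"
      by (rule sum.mono_neutral_cong_right) (use that in auto)
    also have "\<dots> \<le> (\<Sum>i\<in>F. (cmod (f i))\<^sup>2)"
      by (rule sum_mono2) (use assms in auto)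
    finally show ?thesis
      unfolding L2_set_def by (rule real_sqrt_le_mono)
  qed
  show "(\<lambda>i. if i \<in> F then f i else 0) \<in> carrier ell2"
    by (rule ell2I(1)[OF le])
  show "hnorm ell2 (\<lambda>i. if i \<in> F then f i else 0) \<le> L2_set (\<lambda>i. cmod (f i)) F"
    by (rule ell2I(2)[OF le])
qed

lemma ell2_unit [simp]: "ell2_unit j \<in> carrier ell2"
  using ell2_finite_support(1)[of "{j}" "\<lambda>_. 1"] by (simp add: ell2_unit_def)

lemma cinner_ell2_unit: "cinner ell2 f (ell2_unit j) = f j"
proof -
  have "((\<lambda>i. f i * cnj (ell2_unit j i)) has_sum (\<Sum>i\<in>{j}. f i * cnj (ell2_unit j i))) UNIV"
    by (rule has_sum_finite_neutralI[where B = "{j}"]) (auto simp: ell2_unit_def)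
  then show ?thesis by (simp add: infsumI ell2_unit_def)
qed

lemma cinner_bounded_operator_finite_support:
  assumes "A \<in> bounded_operators ell2" "finite F" "w \<in> carrier ell2"
  shows "cinner ell2 (A (\<lambda>i. if i \<in> F then f i else 0)) w =
    (\<Sum>i\<in>F. f i * cinner ell2 (A (ell2_unit i)) w)"
  using assms(2)
proof induction
  case empty
  then show ?case by (simp add: bounded_operator_ell2_zero[OF assms(1)])
next
  case (insert j F)
  have "(\<lambda>i. if i \<in> insert j F then f i else 0) =
      (\<lambda>i. f j * ell2_unit j i + (if i \<in> F then f i else 0))"
    using insert by (auto simp: ell2_unit_def)
  then have "A (\<lambda>i. if i \<in> insert j F then f i else 0) =
      (\<lambda>i. f j * A (ell2_unit j) i + A (\<lambda>i. if i \<in> F then f i else 0) i)"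
    using insert
    by (simp only: bounded_operator_ell2_add[OF assms(1) ell2_smult(1)[OF ell2_unit] ell2_finite_support(1)]
        bounded_operator_ell2_smult[OF assms(1) ell2_unit])
  then have "cinner ell2 (A (\<lambda>i. if i \<in> insert j F then f i else 0)) w =
      f j * cinner ell2 (A (ell2_unit j)) w + cinner ell2 (A (\<lambda>i. if i \<in> F then f i else 0)) w"
    using insert assms
    by (simp only: cinner_ell2_add_left ell2_smult(1) bounded_operator_ell2_closed ell2_unit
        ell2_finite_support(1) cinner_ell2_smult_left)
  then show ?case using insert by simp
qed

text \<open>The squared norm of the remainder is the total sum minus the partial sum over
  \<open>F\<close>.\<close>

lemma ell2_truncation_tendsto:
  assumes "f \<in> carrier ell2"
  shows "((\<lambda>F. hnorm ell2 (\<lambda>i. f i - (if i \<in> F then f i else 0))) \<longlongrightarrow> 0) (finite_subsets_at_top UNIV)"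
proof -
  define S where "S = (\<Sum>\<^sub>\<infinity>i. (cmod (f i))\<^sup>2)"
  have sum: "(\<lambda>i. (cmod (f i))\<^sup>2) summable_on UNIV" using assms by (simp add: mem_ell2)
  have eq: "hnorm ell2 (\<lambda>i. f i - (if i \<in> F then f i else 0)) = sqrt (S - (\<Sum>i\<in>F. (cmod (f i))\<^sup>2))"
    if "finite F" for F
  proof -
    have "(\<Sum>\<^sub>\<infinity>i. (cmod (f i - (if i \<in> F then f i else 0)))\<^sup>2) = (\<Sum>\<^sub>\<infinity>i\<in>UNIV - F. (cmod (f i))\<^sup>2)"
      by (rule infsum_cong_neutral) auto
    also have "\<dots> = S - (\<Sum>\<^sub>\<infinity>i\<in>F. (cmod (f i))\<^sup>2)"
      unfolding S_def using that by (intro infsum_Diff sum) auto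
    finally show ?thesis
      using that assms by (simp add: hnorm_ell2 ell2_diff ell2_finite_support)
  qed
  have "((\<lambda>F. \<Sum>i\<in>F. (cmod (f i))\<^sup>2) \<longlongrightarrow> S) (finite_subsets_at_top UNIV)"
    using has_sum_infsum[OF sum] unfolding has_sum_def S_def .
  then have "((\<lambda>F. sqrt (S - (\<Sum>i\<in>F. (cmod (f i))\<^sup>2))) \<longlongrightarrow> sqrt (S - S)) (finite_subsets_at_top UNIV)"
    by (intro tendsto_intros)
  then have "((\<lambda>F. sqrt (S - (\<Sum>i\<in>F. (cmod (f i))\<^sup>2))) \<longlongrightarrow> 0) (finite_subsets_at_top UNIV)"
    by simp
  moreover have "\<forall>\<^sub>F F in finite_subsets_at_top UNIV.
      sqrt (S - (\<Sum>i\<in>F. (cmod (f i))\<^sup>2)) = hnorm ell2 (\<lambda>i. f i - (if i \<in> F then f i else 0))"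
    by (rule eventually_finite_subsets_at_top_weakI) (simp add: eq)
  ultimately show ?thesis
    by (rule Lim_transform_eventually)
qed

text \<open>The coefficients of the adjoint are forced: coordinate \<open>i\<close> of
  \<open>B w\<close> is the inner product of \<open>w\<close> with \<open>A (ell2_unit i)\<close>.
  What remains is a norm bound and the extension of the adjoint identity from finitely supported
  vectors by continuity.\<close>

theorem ell2_adjoint_exists:
  assumes A: "A \<in> bounded_operators (ell2 :: ('i \<Rightarrow> complex) hilbert)"
  obtains B where "B \<in> bounded_operators ell2" "adjoint_pair ell2 A B"
proof -
  obtain K where K: "K \<ge> 0" "\<And>f. f \<in> carrier ell2 \<Longrightarrow> hnorm ell2 (A f) \<le> K * hnorm ell2 f"
    using bounded_operator_ell2_bound[OF A] by blast
  note Acl = bounded_operator_ell2_closed[OF A]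
  define b where "b w i = cinner ell2 w (A (ell2_unit i))" for w i
  have cnj_b: "cnj (b w i) = cinner ell2 (A (ell2_unit i)) w" for w i
    unfolding b_def by (rule cinner_ell2_commute[symmetric])
  have le: "L2_set (\<lambda>i. cmod (b w i)) F \<le> K * hnorm ell2 w"
    if w: "w \<in> carrier ell2" and F: "finite F" for w F
  proof -
    \<comment> \<open>With the truncation of \<open>b w\<close> as test vector,
      \<open>cinner ell2 (A v) w\<close> is the squared norm of the finite section. One factor of
      that norm cancels at the end.\<close>
    define v where "v = (\<lambda>i. if i \<in> F then b w i else 0)"
    have v: "v \<in> carrier ell2" "hnorm ell2 v \<le> L2_set (\<lambda>i. cmod (b w i)) F"
      unfolding v_def using F by (rule ell2_finite_support)+
    have "of_real ((L2_set (\<lambda>i. cmod (b w i)) F)\<^sup>2) = (\<Sum>i\<in>F. b w i * cnj (b w i))"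
      unfolding L2_set_def by (simp add: sum_nonneg flip: complex_norm_square)
    also have "\<dots> = cinner ell2 (A v) w"
      unfolding v_def cinner_bounded_operator_finite_support[OF A F w] cnj_b ..
    finally have "(L2_set (\<lambda>i. cmod (b w i)) F)\<^sup>2 \<le> hnorm ell2 (A v) * hnorm ell2 w"
      using cinner_ell2_le[OF Acl[OF v(1)] w] by (metis abs_power2 norm_of_real)
    also have "\<dots> \<le> (K * L2_set (\<lambda>i. cmod (b w i)) F) * hnorm ell2 w"
      using order_trans[OF K(2)[OF v(1)] mult_left_mono[OF v(2) K(1)]] w
      by (intro mult_right_mono) auto
    finally show ?thesis
      using K(1) w by (cases "L2_set (\<lambda>i. cmod (b w i)) F = 0")
        (auto simp: power2_eq_square mult.assoc mult.left_commute[of K] order.strict_iff_order)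
  qed
  have b: "b w \<in> carrier ell2" "hnorm ell2 (b w) \<le> K * hnorm ell2 w" if "w \<in> carrier ell2" for w
    using ell2I(1)[OF le[OF that]] ell2I(2)[OF le[OF that]] by simp_all
  define B where "B = (\<lambda>w\<in>carrier ell2. b w)"
  show thesis
  proof (rule that)
    have "b (\<lambda>i. v i + w i) = (\<lambda>i. b v i + b w i)"
      if "v \<in> carrier ell2" "w \<in> carrier ell2" for v w
      unfolding b_def using that by (intro ext cinner_ell2_add_left Acl ell2_unit)
    moreover have "b (\<lambda>i. c * v i) = (\<lambda>i. c * b v i)" for c v
      unfolding b_def by (intro ext cinner_ell2_smult_left)
    ultimately show "B \<in> bounded_operators ell2"
      using b by (auto simp: B_def bounded_operators_def ell2_add ell2_smult intro!: exI[of _ K])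
    have "cinner ell2 (A v) w = cinner ell2 v (b w)"
      if v: "v \<in> carrier ell2" and w: "w \<in> carrier ell2" for v w
    proof -
      define t where "t F = (\<lambda>i. if i \<in> F then v i else 0)" for F
      have t: "t F \<in> carrier ell2" if "finite F" for F
        unfolding t_def using that by (rule ell2_finite_support)
      \<comment> \<open>Boundedness of \<open>A\<close> lets the truncations \<open>t F\<close>
        approximate \<open>v\<close> under the inner product. For finite \<open>F\<close> the
        approximating value is a partial sum of the series for
        \<open>cinner ell2 v (b w)\<close>.\<close>
      have "((\<lambda>F. cinner ell2 (A v) w - cinner ell2 (A (t F)) w) \<longlongrightarrow> 0) (finite_subsets_at_top UNIV)"
      proof (rule Lim_null_comparison)
        show "\<forall>\<^sub>F F in finite_subsets_at_top UNIV. norm (cinner ell2 (A v) w - cinner ell2 (A (t F)) w)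
            \<le> K * hnorm ell2 (\<lambda>i. v i - t F i) * hnorm ell2 w"
        proof (rule eventually_finite_subsets_at_top_weakI)
          fix F :: "'i set" assume "finite F"
          note t = t[OF this]
          have d: "(\<lambda>i. v i - t F i) \<in> carrier ell2" using v t by (rule ell2_diff)
          have "A v = (\<lambda>i. A (\<lambda>i. v i - t F i) i + A (t F) i)"
            using bounded_operator_ell2_add[OF A d t] by simp
          then have "cinner ell2 (A v) w - cinner ell2 (A (t F)) w = cinner ell2 (A (\<lambda>i. v i - t F i)) w"
            using cinner_ell2_add_left[OF Acl[OF d] Acl[OF t] w] by simp
          also have "cmod \<dots> \<le> hnorm ell2 (A (\<lambda>i. v i - t F i)) * hnorm ell2 w"
            by (rule cinner_ell2_le[OF Acl[OF d] w])
          also have "\<dots> \<le> K * hnorm ell2 (\<lambda>i. v i - t F i) * hnorm ell2 w"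
            using K(2)[OF d] w by (intro mult_right_mono) auto
          finally show "cmod (cinner ell2 (A v) w - cinner ell2 (A (t F)) w)
            \<le> K * hnorm ell2 (\<lambda>i. v i - t F i) * hnorm ell2 w" .
        qed
        show "((\<lambda>F. K * hnorm ell2 (\<lambda>i. v i - t F i) * hnorm ell2 w) \<longlongrightarrow> 0) (finite_subsets_at_top UNIV)"
          unfolding t_def
          by (rule tendsto_mult_left_zero tendsto_mult_right_zero ell2_truncation_tendsto v)+
      qed
      from tendsto_diff[OF tendsto_const[of "cinner ell2 (A v) w"] this]
      have "((\<lambda>F. cinner ell2 (A (t F)) w) \<longlongrightarrow> cinner ell2 (A v) w) (finite_subsets_at_top UNIV)"
        by simp
      moreover have "\<forall>\<^sub>F F in finite_subsets_at_top UNIV.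
          cinner ell2 (A (t F)) w = (\<Sum>i\<in>F. v i * cnj (b w i))"
        by (rule eventually_finite_subsets_at_top_weakI)
          (simp only: t_def cinner_bounded_operator_finite_support[OF A _ w] cnj_b)
      ultimately have "((\<lambda>i. v i * cnj (b w i)) has_sum cinner ell2 (A v) w) UNIV"
        unfolding has_sum_def by (rule Lim_transform_eventually)
      then show ?thesis by (simp add: infsumI)
    qed
    then show "adjoint_pair ell2 A B"
      unfolding adjoint_pair_def B_def by (simp del: ell2_simps)
  qed
qed

section \<open>Unitaries and their commutants as von Neumann algebras\<close>

lemma unitary_group_subset: "carrier (unitary_group H) \<subseteq> bounded_operators H"
  by (auto simp: unitary_group_def)

lemma unitary_groupD:
  assumes "U \<in> carrier (unitary_group H)"
  shows "U \<in> bounded_operators H" and "U ` carrier H = carrier H"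
    and "\<lbrakk>v \<in> carrier H; w \<in> carrier H\<rbrakk> \<Longrightarrow> cinner H (U v) (U w) = cinner H v w"
  using assms by (auto simp: unitary_group_def)

lemma hnorm_unitary:
  "U \<in> carrier (unitary_group H) \<Longrightarrow> v \<in> carrier H \<Longrightarrow> hnorm H (U v) = hnorm H v"
  by (simp add: hnorm_def unitary_groupD)

text \<open>Because unitaries are isometric and onto, the adjoint of an operator commuting with
  \<open>S\<close> commutes with \<open>S\<close> too, even if \<open>S\<close> is not closed under
  inverses. The double commutant condition is \<open>triple_commutant\<close>.\<close>

lemma von_neumann_algebra_commutant_ell2:
  fixes S :: "(('i \<Rightarrow> complex) \<Rightarrow> 'i \<Rightarrow> complex) set"
  assumes S: "S \<subseteq> carrier (unitary_group ell2)"
  shows "von_neumann_algebra ell2 (commutant ell2 S)"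
proof -
  have Sb: "S \<subseteq> bounded_operators ell2" using S unitary_group_subset by blast
  have "\<exists>B\<in>commutant ell2 S. adjoint_pair ell2 A B" if A: "A \<in> commutant ell2 S" for A
  proof -
    have Ab: "A \<in> bounded_operators ell2" using A commutant_subset by blast
    obtain B where B: "B \<in> bounded_operators ell2" "adjoint_pair ell2 A B"
      using ell2_adjoint_exists[OF Ab] .
    note adj = B(2)[unfolded adjoint_pair_def, rule_format]
    have "U (B w) = B (U w)" if U: "U \<in> S" and w: "w \<in> carrier ell2" for U w
    proof
      fix j
      have Uu: "U \<in> carrier (unitary_group ell2)" using U S by blast
      note Ucl = bounded_operator_ell2_closed[OF unitary_groupD(1)[OF Uu]]
      note Acl = bounded_operator_ell2_closed[OF Ab]
      note Bcl = bounded_operator_ell2_closed[OF B(1)]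
      \<comment> \<open>Testing against \<open>U v\<close> instead of the unit vector itself allows
        \<open>U\<close> to be cancelled by isometry.\<close>
      obtain v where v: "v \<in> carrier ell2" "ell2_unit j = U v"
        using unitary_groupD(2)[OF Uu] ell2_unit[of j] by blast
      have "cinner ell2 (U v) (B (U w)) = cinner ell2 (A (U v)) (U w)"
        using adj Ucl v w by simp
      also have "A (U v) = U (A v)"
        using A U v unfolding mem_commutant[OF Sb] by simp
      also have "cinner ell2 (U (A v)) (U w) = cinner ell2 (A v) w"
        using v w Acl by (intro unitary_groupD(3)[OF Uu])
      also have "\<dots> = cinner ell2 v (B w)"
        using adj v w by simp
      also have "\<dots> = cinner ell2 (U v) (U (B w))"
        using v w Bcl by (intro unitary_groupD(3)[OF Uu, symmetric])
      finally have "cinner ell2 (ell2_unit j) (B (U w)) = cinner ell2 (ell2_unit j) (U (B w))"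
        unfolding v(2) .
      then have "cinner ell2 (B (U w)) (ell2_unit j) = cinner ell2 (U (B w)) (ell2_unit j)"
        by (metis cinner_ell2_commute)
      then show "U (B w) j = B (U w) j"
        by (simp only: cinner_ell2_unit)
    qed
    then have "B \<in> commutant ell2 S"
      using B unfolding mem_commutant[OF Sb] by blast
    with B show ?thesis by blast
  qed
  then show ?thesis
    unfolding von_neumann_algebra_def
    using commutant_subset triple_commutant[OF Sb] by blast
qed

lemma identity_bounded_operators: "(\<lambda>v\<in>carrier ell2. v) \<in> bounded_operators ell2"
  by (auto simp: bounded_operators_def ell2_add ell2_smult intro!: exI[of _ 1])

lemma identity_mem_commutant:
  assumes "S \<subseteq> bounded_operators ell2"
  shows "(\<lambda>v\<in>carrier ell2. v) \<in> commutant ell2 S"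
  unfolding mem_commutant[OF assms]
  using identity_bounded_operators assms bounded_operator_ell2_closed by auto

text \<open>For a selfadjoint idempotent the squared norm of \<open>E v\<close> is
  \<open>cinner ell2 v (E v)\<close>; Cauchy-Schwarz then lets one factor cancel.\<close>

lemma hnorm_projection_ell2:
  assumes E: "projection ell2 E" and v: "v \<in> carrier ell2"
  shows "hnorm ell2 (E v) \<le> hnorm ell2 v"
proof -
  have Ev: "E v \<in> carrier ell2"
    using E v bounded_operator_ell2_closed by (auto simp: projection_def)
  have "E (E v) = E v"
    using E v unfolding projection_def compose_def by (metis restrict_apply')
  then have "cinner ell2 (E v) (E v) = cinner ell2 v (E v)"
    using E v Ev unfolding projection_def adjoint_pair_def by metis
  then have "(hnorm ell2 (E v))\<^sup>2 \<le> hnorm ell2 v * hnorm ell2 (E v)"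
    using cinner_ell2_le[OF v Ev] hnorm_ell2_sq[OF Ev] by (metis abs_power2 norm_of_real)
  then show ?thesis
    using Ev v by (cases "hnorm ell2 (E v) = 0") (auto simp: power2_eq_square order.strict_iff_order)
qed

section \<open>Permutation operators with phases\<close>

definition weighted_permutation ::
    "('i \<Rightarrow> complex) \<Rightarrow> ('i \<Rightarrow> 'i) \<Rightarrow> ('i \<Rightarrow> complex) \<Rightarrow> 'i \<Rightarrow> complex" where
  "weighted_permutation \<phi> \<sigma> = (\<lambda>v\<in>carrier ell2. \<lambda>i. \<phi> i * v (\<sigma> i))"

lemma weighted_permutation_ell2:
  assumes "bij \<sigma>" "\<And>i. cmod (\<phi> i) = 1" "v \<in> carrier ell2"
  shows "(\<lambda>i. \<phi> i * v (\<sigma> i)) \<in> carrier ell2"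
  using assms(2,3) summable_on_reindex_bij_betw[OF assms(1), of "\<lambda>i. (cmod (v i))\<^sup>2"]
  by (simp add: mem_ell2 norm_mult)

lemma weighted_permutation_unitary:
  assumes \<sigma>: "bij \<sigma>" and \<phi>: "\<And>i. cmod (\<phi> i) = 1"
  shows "weighted_permutation \<phi> \<sigma> \<in> carrier (unitary_group ell2)"
proof -
  let ?U = "weighted_permutation \<phi> \<sigma>"
  have U: "?U v = (\<lambda>i. \<phi> i * v (\<sigma> i))" "?U v \<in> carrier ell2" if "v \<in> carrier ell2" for v
    using that weighted_permutation_ell2[OF \<sigma> \<phi> that] by (auto simp: weighted_permutation_def)
  have inner: "cinner ell2 (?U v) (?U w) = cinner ell2 v w"
    if v: "v \<in> carrier ell2" and w: "w \<in> carrier ell2" for v w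
  proof -
    have "\<phi> i * cnj (\<phi> i) = 1" for i
      using complex_norm_square[of "\<phi> i"] by (simp add: \<phi>)
    then have "?U v i * cnj (?U w i) = v (\<sigma> i) * cnj (w (\<sigma> i))" for i
      using v w by (simp add: U(1))
    then show ?thesis
      using infsum_reindex_bij_betw[OF \<sigma>, of "\<lambda>i. v i * cnj (w i)"] by simp
  qed
  have surj: "v \<in> ?U ` carrier ell2" if v: "v \<in> carrier ell2" for v
  proof
    define \<tau> where "\<tau> = inv_into UNIV \<sigma>"
    have \<tau>: "bij \<tau>" "\<And>i. \<tau> (\<sigma> i) = i"
      unfolding \<tau>_def using \<sigma> by (simp_all add: bij_imp_bij_inv bij_is_inj)
    \<comment> \<open>The preimage of \<open>v\<close> undoes the permutation by
      \<open>\<tau>\<close> and divides out the phase at the matching index.\<close>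
    let ?w = "\<lambda>j. inverse (\<phi> (\<tau> j)) * v (\<tau> j)"
    show w: "?w \<in> carrier ell2"
      using \<phi> v by (intro weighted_permutation_ell2 \<tau>) (auto simp: norm_inverse)
    have "\<phi> i \<noteq> 0" for i using \<phi>[of i] by auto
    then show "v = ?U ?w"
      by (simp add: U(1)[OF w] \<tau> flip: mult.assoc)
  qed
  have "?U \<in> bounded_operators ell2"
    unfolding bounded_operators_def
  proof (intro CollectI conjI ballI allI exI[of _ 1])
    show "?U \<in> carrier ell2 \<rightarrow>\<^sub>E carrier ell2"
      using U(2) by (auto simp: weighted_permutation_def)
    show "hnorm ell2 (?U v) \<le> 1 * hnorm ell2 v" if "v \<in> carrier ell2" for v
      using inner[OF that that] by (simp only: hnorm_def)
  qed (simp_all add: U(1) ell2_add ell2_smult algebra_simps)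
  with U(2) inner surj show ?thesis
    unfolding unitary_group_def by (auto simp del: ell2_simps)
qed

section \<open>Twisted regular representations\<close>

text \<open>By \<open>d_add_cong\<close> and \<open>d_locally_constant\<close>, \<open>d\<close>
  numbers the cosets of an open subgroup, and the two congruence assumptions let the bicharacter
  descend to the quotient. Numbering cosets by \<open>nat\<close> realises the representation on
  functions of type \<open>nat \<Rightarrow> complex\<close>.\<close>

locale twisted_regular =
  fixes \<eta> :: "'b::{ab_group_add, topological_space} \<Rightarrow> 'b \<Rightarrow> 'a::{ab_group_add, topological_space}"
    and \<psi> :: "'a \<Rightarrow> complex" and d :: "'b \<Rightarrow> nat" and \<zeta> :: complex
  assumes eta_add_left: "\<eta> (x + y) z = \<eta> x z + \<eta> y z"
    and eta_add_right: "\<eta> z (x + y) = \<eta> z x + \<eta> z y"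
    and psi_add: "\<psi> (v + w) = \<psi> v * \<psi> w"
    and cmod_psi: "cmod (\<psi> w) = 1"
    and psi_locally_constant: "\<exists>U. open U \<and> w \<in> U \<and> (\<forall>w'\<in>U. \<psi> w' = \<psi> w)"
    and surj_d: "surj d"
    and d_add_cong: "d x = d y \<Longrightarrow> d (x + z) = d (y + z)"
    and d_locally_constant: "\<exists>U. open U \<and> x \<in> U \<and> (\<forall>x'\<in>U. d x' = d x)"
    and psi_eta_cong_left: "d x = d y \<Longrightarrow> \<psi> (\<eta> x z) = \<psi> (\<eta> y z)"
    and psi_eta_cong_right: "d x = d y \<Longrightarrow> \<psi> (\<eta> z x) = \<psi> (\<eta> z y)"
    and zeta_neq_1: "\<zeta> \<noteq> 1"
    and asymptotically_central: "finite F \<Longrightarrow> \<exists>u v. \<psi> (\<eta> u v) = \<zeta> * \<psi> (\<eta> v u) \<and>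
      (\<forall>y. d y \<in> F \<longrightarrow> \<psi> (\<eta> u y) = \<psi> (\<eta> y u) \<and> \<psi> (\<eta> v y) = \<psi> (\<eta> y v))"
begin

text \<open>A choice of coset representatives. It need not be additive; the congruence rules below
  replace \<open>e (d x)\<close> by \<open>x\<close> where only the coset matters.\<close>

definition e :: "nat \<Rightarrow> 'b" where "e = inv_into UNIV d"

abbreviation b :: "'b \<Rightarrow> 'b \<Rightarrow> complex" where "b x y \<equiv> \<psi> (\<eta> x y)"

lemma d_e [simp]: "d (e i) = i"
  unfolding e_def using surj_d by (simp add: surj_f_inv_f)

lemma b_add_left: "b (x + y) z = b x z * b y z"
  by (simp add: eta_add_left psi_add)

lemma b_add_right: "b z (x + y) = b z x * b z y"
  by (simp add: eta_add_right psi_add)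

lemma psi_0 [simp]: "\<psi> 0 = 1"
  using psi_add[of 0 0] cmod_psi[of 0] by auto

lemma b_0 [simp]: "b 0 x = 1" "b x 0 = 1"
  using eta_add_left[of 0 0 x] eta_add_right[of x 0 0] by simp_all

lemma d_diff_cong [simp]: "d (e (d x) - z) = d (x - z)"
  using d_add_cong[of "e (d x)" x "- z"] by simp

lemma d_plus_cong [simp]: "d (e (d x) + z) = d (x + z)"
  by (rule d_add_cong) simp

lemma b_diff_cong [simp]:
  "b (e (d x) - z) y = b (x - z) y" "b y (e (d x) - z) = b y (x - z)"
  by (auto intro: psi_eta_cong_left psi_eta_cong_right)

lemma bij_translate: "bij (\<lambda>i. d (e i - x))"
  by (rule bij_betw_byWitness[where f' = "\<lambda>i. d (e i - (- x))"]) auto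

text \<open>
  In terms of the cosets numbered by \<^term>\<open>d\<close>, these are
  \<open>\<delta>\<^sub>y \<mapsto> \<psi> w * b x y * \<delta>\<^bsub>x + y\<^esub>\<close> and \<open>\<delta>\<^sub>y \<mapsto> b y z * \<delta>\<^bsub>y + z\<^esub>\<close>.
\<close>

definition left :: "'a \<Rightarrow> 'b \<Rightarrow> (nat \<Rightarrow> complex) \<Rightarrow> nat \<Rightarrow> complex" where
  "left w x = weighted_permutation (\<lambda>i. \<psi> w * b x (e i - x)) (\<lambda>i. d (e i - x))"

definition right :: "'b \<Rightarrow> (nat \<Rightarrow> complex) \<Rightarrow> nat \<Rightarrow> complex" where
  "right z = weighted_permutation (\<lambda>i. b (e i - z) z) (\<lambda>i. d (e i - z))"

section \<open>The two regular representations and their commutation relations\<close>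

lemma left_unitary: "left w x \<in> carrier (unitary_group ell2)"
  unfolding left_def
  by (rule weighted_permutation_unitary) (auto simp: bij_translate norm_mult cmod_psi)

lemma right_unitary: "right z \<in> carrier (unitary_group ell2)"
  unfolding right_def
  by (rule weighted_permutation_unitary) (auto simp: bij_translate cmod_psi)

lemmas left_bounded = unitary_groupD(1)[OF left_unitary]
lemmas right_bounded = unitary_groupD(1)[OF right_unitary]
lemmas left_closed = bounded_operator_ell2_closed[OF left_bounded]
lemmas right_closed = bounded_operator_ell2_closed[OF right_bounded]

lemma left_apply:
  "v \<in> carrier ell2 \<Longrightarrow> left w x v = (\<lambda>i. \<psi> w * b x (e i - x) * v (d (e i - x)))"
  by (simp add: left_def weighted_permutation_def)

lemma right_apply:
  "v \<in> carrier ell2 \<Longrightarrow> right z v = (\<lambda>i. b (e i - z) z * v (d (e i - z)))"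
  by (simp add: right_def weighted_permutation_def)

text \<open>With \<open>y = e i - x - z\<close>, the phase \<open>b x (y + z)\<close> of the
  composition splits off \<open>b x z\<close>, which is exactly what the central shift by
  \<open>\<eta> x z\<close> contributes.\<close>

lemma left_mult:
  "left (w + w' + \<eta> x z) (x + z) = compose (carrier ell2) (left w x) (left w' z)"
proof (rule extensionalityI[where A = "carrier ell2"])
  fix v :: "nat \<Rightarrow> complex" assume v: "v \<in> carrier ell2"
  have "left (w + w' + \<eta> x z) (x + z) v i = left w x (left w' z v) i" for i
  proof -
    define y where "y = e i - x - z"
    have y: "e i - (x + z) = y" "e i - x = y + z" by (simp_all add: y_def)
    show ?thesis
      unfolding left_apply[OF left_closed[OF v]] unfolding left_apply[OF v]
      by (simp add: y psi_add b_add_left b_add_right)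
  qed
  then show "left (w + w' + \<eta> x z) (x + z) v = compose (carrier ell2) (left w x) (left w' z) v"
    using v by (auto simp: compose_def)
qed (auto simp: left_def weighted_permutation_def compose_def)

text \<open>In either order the phase is \<open>\<psi> w * b x y * b x z * b y z\<close> for
  \<open>y = e i - x - z\<close>.\<close>

lemma left_right_commute:
  assumes v: "v \<in> carrier ell2"
  shows "left w x (right z v) = right z (left w x v)"
proof
  fix i
  define y where "y = e i - x - z"
  have y: "e i - x = y + z" "e i - z = y + x" by (simp_all add: y_def)
  show "left w x (right z v) i = right z (left w x v) i"
    unfolding left_apply[OF right_closed[OF v]] right_apply[OF left_closed[OF v]]
    unfolding left_apply[OF v] right_apply[OF v]
    by (simp add: y b_add_left b_add_right)
qed

text \<open>The phases of the two orders share the factors \<open>b y x\<close> and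
  \<open>b y z\<close> and differ only in \<open>b x z\<close> against \<open>b z x\<close>.\<close>

lemma right_right_commute:
  assumes v: "v \<in> carrier ell2" and "b x z = \<zeta> * b z x"
  shows "right z (right x v) = (\<lambda>i. \<zeta> * right x (right z v) i)"
proof
  fix i
  define y where "y = e i - x - z"
  have y: "e i - x = y + z" "e i - z = y + x" by (simp_all add: y_def)
  show "right z (right x v) i = \<zeta> * right x (right z v) i"
    unfolding right_apply[OF right_closed[OF v]] unfolding right_apply[OF v]
    by (simp add: y b_add_left assms(2))
qed

section \<open>Vanishing of abelian projections\<close>

lemma d_diff_eq_d_0: "d (e i - x) = d 0 \<longleftrightarrow> i = d x"
proof
  assume "d (e i - x) = d 0"
  from d_add_cong[OF this, of x] show "i = d x" by simp
qed simp

text \<open>No phase remains since \<open>b 0 x = 1\<close>. Right translations thus reach every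
  unit vector from the one at \<open>d 0\<close>, which is therefore separating for bounded
  operators commuting with them.\<close>

lemma right_ell2_unit: "right x (ell2_unit (d 0)) = ell2_unit (d x)"
proof
  fix i
  have "b (e i - x) x = 1" if "i = d x"
    using psi_eta_cong_left[of "e i - x" 0 x] that by (simp add: d_diff_eq_d_0)
  then show "right x (ell2_unit (d 0)) i = ell2_unit (d x) i"
    unfolding right_apply[OF ell2_unit] by (simp add: ell2_unit_def d_diff_eq_d_0)
qed

text \<open>\<open>left 0 x\<close> and \<open>right x\<close> translate alike and differ only in
  the phases \<open>b x y\<close> and \<open>b y x\<close>. They agree on a truncation of
  \<open>\<xi>\<close> once these phases match on its support; by unitarity the remainder costs
  twice its norm, hence the \<open>\<epsilon> / 2\<close>.\<close>

lemma left_approx_right: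
  assumes \<xi>: "\<xi> \<in> carrier ell2" and "\<epsilon> > 0"
  obtains u v where "b u v = \<zeta> * b v u"
    "hnorm ell2 (\<lambda>i. left 0 u \<xi> i - right u \<xi> i) \<le> \<epsilon>"
    "hnorm ell2 (\<lambda>i. left 0 v \<xi> i - right v \<xi> i) \<le> \<epsilon>"
proof -
  have "\<forall>\<^sub>F F in finite_subsets_at_top UNIV. hnorm ell2 (\<lambda>i. \<xi> i - (if i \<in> F then \<xi> i else 0)) < \<epsilon> / 2"
    using order_tendstoD(2)[OF ell2_truncation_tendsto[OF \<xi>], of "\<epsilon> / 2"] \<open>\<epsilon> > 0\<close> by simp
  then obtain F where F: "finite F" "hnorm ell2 (\<lambda>i. \<xi> i - (if i \<in> F then \<xi> i else 0)) < \<epsilon> / 2"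
    unfolding eventually_finite_subsets_at_top by blast
  define \<xi>' where "\<xi>' = (\<lambda>i. if i \<in> F then \<xi> i else 0)"
  define \<rho> where "\<rho> = (\<lambda>i. \<xi> i - \<xi>' i)"
  have \<xi>': "\<xi>' \<in> carrier ell2" unfolding \<xi>'_def by (rule ell2_finite_support(1)[OF F(1)])
  have \<rho>: "\<rho> \<in> carrier ell2" unfolding \<rho>_def by (rule ell2_diff(1)[OF \<xi> \<xi>'])
  obtain u v where uv: "b u v = \<zeta> * b v u"
    "\<And>y. d y \<in> F \<Longrightarrow> b u y = b y u" "\<And>y. d y \<in> F \<Longrightarrow> b v y = b y v"
    using asymptotically_central[OF F(1)] by blast
  have "hnorm ell2 (\<lambda>i. left 0 x \<xi> i - right x \<xi> i) \<le> \<epsilon>"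
    if x: "\<And>y. d y \<in> F \<Longrightarrow> b x y = b y x" for x
  proof -
    have eq: "left 0 x \<xi>' = right x \<xi>'"
      unfolding left_apply[OF \<xi>'] right_apply[OF \<xi>'] by (auto simp: \<xi>'_def x)
    have "left 0 x \<rho> = (\<lambda>i. left 0 x \<xi> i - left 0 x \<xi>' i)" "right x \<rho> = (\<lambda>i. right x \<xi> i - right x \<xi>' i)"
      unfolding \<rho>_def by (rule bounded_operator_ell2_diff[OF left_bounded \<xi> \<xi>']
          bounded_operator_ell2_diff[OF right_bounded \<xi> \<xi>'])+
    then have "(\<lambda>i. left 0 x \<xi> i - right x \<xi> i) = (\<lambda>i. left 0 x \<rho> i - right x \<rho> i)"
      by (simp add: eq)
    then have "hnorm ell2 (\<lambda>i. left 0 x \<xi> i - right x \<xi> i) \<le> hnorm ell2 (left 0 x \<rho>) + hnorm ell2 (right x \<rho>)"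
      using ell2_diff(2)[OF left_closed[OF \<rho>] right_closed[OF \<rho>]] by simp
    also have "\<dots> = hnorm ell2 \<rho> + hnorm ell2 \<rho>"
      by (simp only: hnorm_unitary[OF left_unitary \<rho>] hnorm_unitary[OF right_unitary \<rho>])
    also have "\<dots> \<le> \<epsilon>"
      using F(2) by (simp add: \<rho>_def \<xi>'_def)
    finally show ?thesis .
  qed
  then show thesis using that uv by blast
qed

lemma no_abelian_projection:
  assumes E: "projection ell2 E"
    and E_right: "\<And>z v. v \<in> carrier ell2 \<Longrightarrow> right z (E v) = E (right z v)"
    and comm: "\<And>x y v. v \<in> carrier ell2 \<Longrightarrow>
      E (left 0 x (E (left 0 y (E v)))) = E (left 0 y (E (left 0 x (E v))))"
  shows "E = zero_operator ell2"
proof -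
  have Eb: "E \<in> bounded_operators ell2" using E by (simp add: projection_def)
  note Ecl = bounded_operator_ell2_closed[OF Eb]
  have adj: "cinner ell2 (E v) w = cinner ell2 v (E w)"
    if "v \<in> carrier ell2" "w \<in> carrier ell2" for v w
    using E that unfolding projection_def adjoint_pair_def by (simp only:)
  have EE: "E (E v) = E v" if "v \<in> carrier ell2" for v
    using E that unfolding projection_def compose_def by (metis restrict_apply')
  define \<xi> where "\<xi> = E (ell2_unit (d 0))"
  have \<xi>: "\<xi> \<in> carrier ell2" "E \<xi> = \<xi>" by (simp_all add: \<xi>_def Ecl EE)
  note cl = \<xi>(1) Ecl left_closed right_closed
  \<comment> \<open>The left translations are replaced by right ones one at a time. As
    \<open>E\<close> is a contraction and translations are isometries, each replacement costs at
    most \<open>\<epsilon>\<close>.\<close>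
  have close: "hnorm ell2 (\<lambda>i. E (left 0 x (E (left 0 y \<xi>))) i - right y (right x \<xi>) i) \<le> 2 * \<epsilon>"
    if x: "hnorm ell2 (\<lambda>i. left 0 x \<xi> i - right x \<xi> i) \<le> \<epsilon>"
      and y: "hnorm ell2 (\<lambda>i. left 0 y \<xi> i - right y \<xi> i) \<le> \<epsilon>" for x y \<epsilon>
  proof -
    have contract: "hnorm ell2 (\<lambda>i. E f i - E g i) \<le> hnorm ell2 (\<lambda>i. f i - g i)"
      if "f \<in> carrier ell2" "g \<in> carrier ell2" for f g
      using hnorm_projection_ell2[OF E ell2_diff(1)[OF that]] bounded_operator_ell2_diff[OF Eb that]
      by simp
    have isometry: "hnorm ell2 (\<lambda>i. U f i - U g i) = hnorm ell2 (\<lambda>i. f i - g i)"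
      if "U \<in> carrier (unitary_group ell2)" "f \<in> carrier ell2" "g \<in> carrier ell2"
      for f g and U :: "(nat \<Rightarrow> complex) \<Rightarrow> nat \<Rightarrow> complex"
      using hnorm_unitary[OF that(1) ell2_diff(1)[OF that(2,3)]]
        bounded_operator_ell2_diff[OF unitary_groupD(1)[OF that(1)] that(2,3)]
      by simp
    have fixed: "E (right z \<xi>) = right z \<xi>" for z
      using E_right[OF \<xi>(1), of z] \<xi>(2) by simp
    have "hnorm ell2 (\<lambda>i. E (left 0 x (E (left 0 y \<xi>))) i - E (left 0 x (E (right y \<xi>))) i)
        \<le> hnorm ell2 (\<lambda>i. left 0 x (E (left 0 y \<xi>)) i - left 0 x (E (right y \<xi>)) i)"
      by (intro contract cl)
    also have "\<dots> = hnorm ell2 (\<lambda>i. E (left 0 y \<xi>) i - E (right y \<xi>) i)"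
      by (intro isometry left_unitary cl)
    also have "\<dots> \<le> hnorm ell2 (\<lambda>i. left 0 y \<xi> i - right y \<xi> i)"
      by (intro contract cl)
    also note y
    finally have 1: "hnorm ell2 (\<lambda>i. E (left 0 x (E (left 0 y \<xi>))) i - E (left 0 x (E (right y \<xi>))) i) \<le> \<epsilon>" .
    \<comment> \<open>\<open>E\<close> fixes \<open>right y \<xi>\<close>, so the right translation
      can be moved outside and the second replacement again happens at \<open>\<xi>\<close>.\<close>
    have "E (left 0 x (E (right y \<xi>))) = right y (E (left 0 x \<xi>))"
      unfolding fixed left_right_commute[OF \<xi>(1)] by (rule E_right[symmetric]) (intro cl)
    moreover have "right y (right x \<xi>) = right y (E (right x \<xi>))"
      unfolding fixed ..
    ultimately have "hnorm ell2 (\<lambda>i. E (left 0 x (E (right y \<xi>))) i - right y (right x \<xi>) i)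
        = hnorm ell2 (\<lambda>i. right y (E (left 0 x \<xi>)) i - right y (E (right x \<xi>)) i)"
      by simp
    also have "\<dots> = hnorm ell2 (\<lambda>i. E (left 0 x \<xi>) i - E (right x \<xi>) i)"
      by (intro isometry right_unitary cl)
    also have "\<dots> \<le> hnorm ell2 (\<lambda>i. left 0 x \<xi> i - right x \<xi> i)"
      by (intro contract cl)
    also note x
    finally have 2: "hnorm ell2 (\<lambda>i. E (left 0 x (E (right y \<xi>))) i - right y (right x \<xi>) i) \<le> \<epsilon>" .
    have "hnorm ell2 (\<lambda>i. E (left 0 x (E (left 0 y \<xi>))) i - right y (right x \<xi>) i) \<le>
        hnorm ell2 (\<lambda>i. E (left 0 x (E (left 0 y \<xi>))) i - E (left 0 x (E (right y \<xi>))) i) +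
        hnorm ell2 (\<lambda>i. E (left 0 x (E (right y \<xi>))) i - right y (right x \<xi>) i)"
      by (intro hnorm_ell2_diff_triangle cl)
    with 1 2 show ?thesis by simp
  qed
  \<comment> \<open>Both orders of the right translations lie within \<open>2 * \<epsilon>\<close>
    of the same vector \<open>a\<close>, whence the constant 4.\<close>
  have bound: "cmod (\<zeta> - 1) * hnorm ell2 \<xi> \<le> 4 * \<epsilon>" if \<epsilon>: "\<epsilon> > 0" for \<epsilon>
  proof -
    obtain u v where uv: "b u v = \<zeta> * b v u"
      "hnorm ell2 (\<lambda>i. left 0 u \<xi> i - right u \<xi> i) \<le> \<epsilon>"
      "hnorm ell2 (\<lambda>i. left 0 v \<xi> i - right v \<xi> i) \<le> \<epsilon>"
      using left_approx_right[OF \<xi>(1) \<epsilon>] .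
    define a where "a = E (left 0 u (E (left 0 v \<xi>)))"
    have a: "a = E (left 0 v (E (left 0 u \<xi>)))"
      using comm[OF \<xi>(1), of u v] \<xi>(2) by (simp add: a_def)
    have acl: "a \<in> carrier ell2" unfolding a_def by (intro cl)
    have "(\<lambda>i. (\<zeta> - 1) * right u (right v \<xi>) i) =
        (\<lambda>i. right v (right u \<xi>) i - right u (right v \<xi>) i)"
      by (simp add: right_right_commute[OF \<xi>(1) uv(1)] algebra_simps)
    moreover have "hnorm ell2 (\<lambda>i. right v (right u \<xi>) i - right u (right v \<xi>) i) \<le>
        hnorm ell2 (\<lambda>i. right v (right u \<xi>) i - a i) + hnorm ell2 (\<lambda>i. a i - right u (right v \<xi>) i)"
      by (intro hnorm_ell2_diff_triangle cl acl)
    moreover have "hnorm ell2 (\<lambda>i. right v (right u \<xi>) i - a i) =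
        hnorm ell2 (\<lambda>i. a i - right v (right u \<xi>) i)"
      by (intro hnorm_ell2_minus_commute cl acl)
    moreover have "hnorm ell2 (\<lambda>i. a i - right v (right u \<xi>) i) \<le> 2 * \<epsilon>"
      unfolding a_def by (rule close uv)+
    moreover have "hnorm ell2 (\<lambda>i. a i - right u (right v \<xi>) i) \<le> 2 * \<epsilon>"
      unfolding a by (rule close uv)+
    moreover have "hnorm ell2 (\<lambda>i. (\<zeta> - 1) * right u (right v \<xi>) i) = cmod (\<zeta> - 1) * hnorm ell2 \<xi>"
      by (simp only: ell2_smult(2) cl hnorm_unitary[OF right_unitary])
    ultimately show ?thesis by simp
  qed
  have "cmod (\<zeta> - 1) * hnorm ell2 \<xi> \<le> 0"
  proof (rule field_le_epsilon)
    fix \<epsilon> :: real assume "\<epsilon> > 0"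
    then show "cmod (\<zeta> - 1) * hnorm ell2 \<xi> \<le> 0 + \<epsilon>" using bound[of "\<epsilon> / 4"] by simp
  qed
  then have "hnorm ell2 \<xi> = 0"
    using zeta_neq_1 \<xi>(1) by (simp add: mult_le_0_iff order_antisym)
  then have \<xi>0: "\<xi> = (\<lambda>_. 0)" by (rule hnorm_ell2_eq_0[OF \<xi>(1)])
  have "E v i = 0" if v: "v \<in> carrier ell2" for v i
  proof -
    \<comment> \<open>Equivariance spreads the vanishing of \<open>\<xi>\<close> to all unit
      vectors; selfadjointness then kills every coordinate of \<open>E v\<close>.\<close>
    have "E (ell2_unit i) = right (e i) \<xi>"
      using right_ell2_unit[of "e i"] by (simp add: \<xi>_def E_right)
    then have 0: "E (ell2_unit i) = (\<lambda>_. 0)"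
      by (simp add: \<xi>0 bounded_operator_ell2_zero[OF right_bounded])
    have "E v i = cinner ell2 (E v) (ell2_unit i)"
      by (rule cinner_ell2_unit[symmetric])
    also have "\<dots> = cinner ell2 v (E (ell2_unit i))"
      by (intro adj v ell2_unit)
    finally show ?thesis by (simp add: 0)
  qed
  moreover have "E v = undefined" if "v \<notin> carrier ell2" for v
    using Eb that by (auto simp: bounded_operators_def)
  ultimately show ?thesis
    by (auto simp: zero_operator_def fun_eq_iff restrict_def)
qed

section \<open>The unitary representation and failure of type I\<close>

lemma unitary_representation_left:
  "unitary_representation (central_extension \<eta>) (prod_topology euclidean euclidean) ell2
    (\<lambda>(w, x). left w x)"
  unfolding unitary_representation_def
proof (intro conjI ballI)
  show "(\<lambda>(w, x). left w x) \<in> hom (central_extension \<eta>) (unitary_group ell2)"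
    \<comment> \<open>Only the product of \<open>unitary_group\<close> is unfolded, so that
      \<open>left_unitary\<close> still applies to its carrier.\<close>
    by (rule homI)
      (auto simp: central_extension_def left_mult left_unitary
        arg_cong[OF unitary_group_def, of monoid.mult])
  fix v :: "nat \<Rightarrow> complex" assume v: "v \<in> carrier ell2"
  have top: "topspace (norm_topology (ell2 :: (nat \<Rightarrow> complex) hilbert)) = carrier ell2"
    unfolding norm_topology_def by (rule Metric_space.topspace_mtopology[OF Metric_space_ell2])
  \<comment> \<open>The operator depends only on \<open>\<psi> w\<close> and \<open>d x\<close>,
    both locally constant, so orbit maps are locally constant and strong continuity follows.\<close>
  have loc: "\<exists>U V. open U \<and> open V \<and> w \<in> U \<and> x \<in> V \<and>
      (\<forall>w'\<in>U. \<forall>x'\<in>V. left w' x' v = left w x v)" for w x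
  proof -
    obtain U where U: "open U" "w \<in> U" "\<forall>w'\<in>U. \<psi> w' = \<psi> w"
      using psi_locally_constant by blast
    obtain V where V: "open V" "x \<in> V" "\<forall>x'\<in>V. d x' = d x"
      using d_locally_constant by blast
    have eq: "left w' x' v = left w x v" if "w' \<in> U" "x' \<in> V" for w' x'
    proof -
      have "d x' = d x" "\<psi> w' = \<psi> w" using U V that by blast+
      \<comment> \<open>Adding \<open>e i - x - x'\<close> turns \<open>x'\<close> and
        \<open>x\<close> into \<open>e i - x\<close> and \<open>e i - x'\<close>.\<close>
      then have "d (e i - x') = d (e i - x)" for i
        using d_add_cong[of x' x "e i - x - x'"] by (simp add: algebra_simps)
      moreover have "b x' (e i - x') = b x (e i - x)" for i
        unfolding psi_eta_cong_left[OF \<open>d x' = d x\<close>]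
        by (rule psi_eta_cong_right) fact
      ultimately show ?thesis using \<open>\<psi> w' = \<psi> w\<close> by (simp add: left_apply v)
    qed
    show ?thesis
      by (intro exI conjI ballI) (rule U(1,2) V(1,2) eq; assumption?)+
  qed
  have "openin (prod_topology euclidean euclidean) {(w, x). left w x v \<in> W}" for W
    unfolding openin_prod_topology_alt
  proof (intro allI impI)
    fix w x assume wx: "(w, x) \<in> {(w, x). left w x v \<in> W}"
    obtain U V where UV: "open U" "open V" "w \<in> U" "x \<in> V"
      "\<forall>w'\<in>U. \<forall>x'\<in>V. left w' x' v = left w x v"
      using loc[of w x] by (elim exE conjE) (rule that)
    have "left w' x' v \<in> W" if "w' \<in> U" "x' \<in> V" for w' x'
      using wx UV(5)[rule_format, OF that] by simp
    then have "U \<times> V \<subseteq> {(w, x). left w x v \<in> W}" by auto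
    with UV(1-4) show "\<exists>U V. openin euclidean U \<and> openin euclidean V \<and> w \<in> U \<and> x \<in> V \<and>
        U \<times> V \<subseteq> {(w, x). left w x v \<in> W}"
      by (intro exI[of _ U] exI[of _ V]) simp
  qed
  then show "continuous_map (prod_topology euclidean euclidean) (norm_topology ell2)
      (\<lambda>g. (\<lambda>(w, x). left w x) g v)"
    by (auto simp: continuous_map_def top left_closed v case_prod_unfold)
qed

theorem not_type_I:
  "\<not> type_I_group TYPE(nat \<Rightarrow> complex) (central_extension \<eta>) (prod_topology euclidean euclidean)"
proof
  assume type_I: "type_I_group TYPE(nat \<Rightarrow> complex) (central_extension \<eta>) (prod_topology euclidean euclidean)"
  define \<pi> where "\<pi> = (\<lambda>(w, x). left w x)"
  define M where "M = generated_von_neumann_algebra ell2 (\<pi> ` carrier (central_extension \<eta>))"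
  have M: "type_I_von_neumann_algebra ell2 M"
    using type_I hilbert_space_ell2 unitary_representation_left
    unfolding type_I_group_def M_def \<pi>_def by blast
  have right: "range right \<subseteq> carrier (unitary_group ell2)"
    using right_unitary by blast
  then have right_b: "range right \<subseteq> bounded_operators ell2"
    using unitary_group_subset by blast
  have left_M: "left w x \<in> M" for w x
    unfolding M_def generated_von_neumann_algebra_def
    by (force simp: \<pi>_def central_extension_def)
  \<comment> \<open>An upper bound for \<open>M\<close> suffices: the commutant of the right
    translations is a von Neumann algebra containing the image of the representation.\<close>
  have "left w x \<in> commutant ell2 (range right)" for w x
    unfolding mem_commutant[OF right_b] using left_bounded left_right_commute by simp
  then have M_comm: "M \<subseteq> commutant ell2 (range right)"
    unfolding M_def generated_von_neumann_algebra_def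
    using von_neumann_algebra_commutant_ell2[OF right] by (intro Inter_lower) (auto simp: \<pi>_def)
  then have Mb: "M \<subseteq> bounded_operators ell2" using commutant_subset by blast
  \<comment> \<open>The type I condition is tested on the identity, which lies in every von Neumann
    algebra because these are double commutants.\<close>
  define I where "I = (\<lambda>v\<in>carrier (ell2 :: (nat \<Rightarrow> complex) hilbert). v)"
  have "I \<in> N" if "von_neumann_algebra ell2 N" for N
    using that identity_mem_commutant[OF commutant_subset[of ell2 N]]
    unfolding von_neumann_algebra_def I_def by simp
  then have "I \<in> M" unfolding M_def generated_von_neumann_algebra_def by blast
  moreover have "projection ell2 I"
    unfolding projection_def I_def
    using identity_bounded_operators by (auto simp: compose_def adjoint_pair_def)
  ultimately have "central_projection ell2 M I"
    unfolding central_projection_def using identity_mem_commutant[OF Mb] by (simp add: I_def)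
  moreover have "I \<noteq> zero_operator ell2"
  proof
    assume "I = zero_operator ell2"
    from fun_cong[OF this, of "ell2_unit 0"] have "ell2_unit 0 = (\<lambda>_ :: nat. 0)"
      by (simp add: I_def zero_operator_def)
    from fun_cong[OF this, of 0] show False by (simp add: ell2_unit_def)
  qed
  ultimately obtain E where E: "abelian_projection ell2 M E" "E \<noteq> zero_operator ell2"
    using M unfolding type_I_von_neumann_algebra_def by blast
  then have EM: "E \<in> M" and Ep: "projection ell2 E"
    by (auto simp: abelian_projection_def)
  have Eb: "E \<in> bounded_operators ell2" using EM Mb by blast
  note Ecl = bounded_operator_ell2_closed[OF Eb]
  have "E = zero_operator ell2"
  proof (rule no_abelian_projection[OF Ep])
    show "right z (E v) = E (right z v)" if "v \<in> carrier ell2" for z v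
      using EM M_comm that unfolding subset_iff mem_commutant[OF right_b] by blast
    show "E (left 0 x (E (left 0 y (E v)))) = E (left 0 y (E (left 0 x (E v))))"
      if v: "v \<in> carrier ell2" for x y v
    proof -
      let ?C = "compose (carrier (ell2 :: (nat \<Rightarrow> complex) hilbert))"
      have EE: "E (E v) = E v" if "v \<in> carrier ell2" for v
        using Ep that unfolding projection_def compose_def by (metis restrict_apply')
      \<comment> \<open>At a vector the adjacent factors \<open>E E\<close> collapse to a single
        \<open>E\<close>.\<close>
      have "?C (?C E (?C (left 0 x) E)) (?C E (?C (left 0 y) E)) =
          ?C (?C E (?C (left 0 y) E)) (?C E (?C (left 0 x) E))"
        using E(1) left_M unfolding abelian_projection_def Let_def by blast
      from fun_cong[OF this, of v] show ?thesis
        using v by (simp add: compose_def Ecl left_closed EE)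
    qed
  qed
  with E show False by blast
qed

end

section \<open>The cocycles on formal Laurent series\<close>

definition mod_ring_character :: "'p::prime_card mod_ring \<Rightarrow> complex" where
  "mod_ring_character a = cis (2 * pi * (to_int_mod_ring a / CARD('p)))"

text \<open>Integer representatives add only up to a multiple of \<open>CARD('p)\<close>, which
  becomes a whole number of full turns.\<close>

lemma mod_ring_character_add:
  fixes a b :: "'p::prime_card mod_ring"
  shows "mod_ring_character (a + b) = mod_ring_character a * mod_ring_character b"
proof -
  define m where "m = to_int_mod_ring a + to_int_mod_ring b"
  have p: "real CARD('p) \<noteq> 0" by simp
  have "m mod int CARD('p) = m - int CARD('p) * (m div int CARD('p))"
    by (simp add: minus_mult_div_eq_mod)
  then have "real_of_int (m mod int CARD('p)) = of_int m - CARD('p) * of_int (m div int CARD('p))"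
    by simp
  then have "real_of_int (m mod int CARD('p)) / CARD('p) = of_int m / CARD('p) - of_int (m div int CARD('p))"
    using p by (simp add: field_simps)
  then have "mod_ring_character (a + b) =
      cis (2 * pi * (of_int m / CARD('p)) - 2 * pi * of_int (m div int CARD('p)))"
    by (simp add: mod_ring_character_def to_int_mod_ring_add m_def right_diff_distrib)
  also have "\<dots> = cis (2 * pi * (of_int m / CARD('p)))"
    by (simp flip: cis_divide)
  also have "\<dots> = mod_ring_character a * mod_ring_character b"
    by (simp add: mod_ring_character_def m_def cis_mult add_divide_distrib distrib_left)
  finally show ?thesis .
qed

lemma cmod_mod_ring_character [simp]: "cmod (mod_ring_character a) = 1"
  by (simp add: mod_ring_character_def)

lemma mod_ring_character_0 [simp]: "mod_ring_character 0 = 1"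
  by (simp add: mod_ring_character_def)

lemma mod_ring_character_1: "mod_ring_character (1 :: 'p::prime_card mod_ring) \<noteq> 1"
proof
  have p: "real CARD('p) > 1" using prime_gt_1_nat[OF prime_card] by simp
  assume "mod_ring_character (1 :: 'p mod_ring) = 1"
  then have "cos (2 * pi * (1 / CARD('p))) = 1"
    by (simp add: mod_ring_character_def complex_eq_iff)
  then obtain n :: int where "2 * pi * (1 / CARD('p)) = real_of_int n * 2 * pi"
    unfolding cos_one_2pi_int by (elim exE)
  then have "2 * pi * real_of_int n = 2 * pi * (1 / CARD('p))" by simp
  then have "real_of_int n = 1 / CARD('p)" unfolding mult_cancel_left by simp
  moreover have "0 < 1 / real CARD('p)" "1 / real CARD('p) < 1" using p by simp_all
  ultimately have "0 < real_of_int n" "real_of_int n < 1" by simp_all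
  then show False by simp
qed

text \<open>Restricting to the nonzero coefficients makes the sum finite; over \<open>k < - int N\<close> it would be \<open>0\<close>.\<close>

definition low_coeff_sum :: "nat \<Rightarrow> 'a::comm_ring_1 fls \<Rightarrow> 'a" where
  "low_coeff_sum N w = (\<Sum>k | k < - int N \<and> fls_nth w k \<noteq> 0. fls_nth w k)"

lemma low_coeff_sum_eq:
  assumes "m \<le> fls_subdegree w"
  shows "low_coeff_sum N w = (\<Sum>k\<in>{m..<- int N}. fls_nth w k)"
  unfolding low_coeff_sum_def
proof (rule sum.mono_neutral_left)
  show "{k. k < - int N \<and> fls_nth w k \<noteq> 0} \<subseteq> {m..<- int N}"
    using assms by (auto simp: not_le intro: ccontr)
qed auto

lemma low_coeff_sum_add: "low_coeff_sum N (v + w) = low_coeff_sum N v + low_coeff_sum N w"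
proof -
  define m where "m = min (fls_subdegree (v + w)) (min (fls_subdegree v) (fls_subdegree w))"
  have "m \<le> fls_subdegree (v + w)" "m \<le> fls_subdegree v" "m \<le> fls_subdegree w"
    by (auto simp: m_def)
  then show ?thesis by (simp add: low_coeff_sum_eq sum.distrib)
qed

lemma low_coeff_sum_cong:
  "(\<And>k. k < - int N \<Longrightarrow> fls_nth v k = fls_nth w k) \<Longrightarrow> low_coeff_sum N v = low_coeff_sum N w"
  unfolding low_coeff_sum_def by (rule sum.cong) auto

lemma low_coeff_sum_eq_0:
  "(\<And>k. k < - int N \<Longrightarrow> fls_nth w k = 0) \<Longrightarrow> low_coeff_sum N w = 0"
  unfolding low_coeff_sum_def by (rule sum.neutral) auto

text \<open>The first arguments may have different subdegrees, so both coefficients are expanded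
  with the common summation bound \<open>M\<close>.\<close>

lemma fls_nth_eta_cong:
  assumes "\<And>n. \<lbrakk>n \<ge> 1; s n \<noteq> 0\<rbrakk> \<Longrightarrow> fls_nth x (k - int n) * fls_nth y (k + int n) =
    fls_nth x' (k - int n) * fls_nth y' (k + int n)"
  shows "fls_nth (eta s x y) k = fls_nth (eta s x' y') k"
proof -
  define M where "M = nat (max (k - fls_subdegree x) (k - fls_subdegree x'))"
  have M: "k - fls_subdegree x \<le> int M" "k - fls_subdegree x' \<le> int M" by (auto simp: M_def)
  have "of_nat (s n) * (fls_nth x (k - int n) * fls_nth y (k + int n)) =
      of_nat (s n) * (fls_nth x' (k - int n) * fls_nth y' (k + int n))" if "n \<ge> 1" for n
    using assms[OF that] by (cases "s n = 0") simp_all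
  then show ?thesis
    unfolding fls_nth_eta[OF M(1)] fls_nth_eta[OF M(2)] by (intro sum.cong) auto
qed

lemma fls_nth_eta_eq_0:
  assumes "\<And>n. \<lbrakk>n \<ge> 1; s n \<noteq> 0\<rbrakk> \<Longrightarrow> fls_nth x (k - int n) * fls_nth y (k + int n) = 0"
  shows "fls_nth (eta s x y) k = 0"
proof -
  have "k - fls_subdegree x \<le> int (nat (k - fls_subdegree x))" by simp
  note fls_nth_eta[OF this]
  moreover have "of_nat (s n) * (fls_nth x (k - int n) * fls_nth y (k + int n)) = 0" if "n \<ge> 1" for n
    using assms[OF that] by (cases "s n = 0") simp_all
  ultimately show ?thesis by (simp only:) (rule sum.neutral, simp)
qed

lemma fls_nth_X_intpow: "fls_nth (fls_X_intpow i) k = (if k = i then 1 else 0)"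
  by simp

text \<open>Distinct series have distance 2 to the power minus the subdegree of their difference, so
  distance below 1 makes that subdegree positive.\<close>

lemma fls_nth_eq_if_dist_less_1:
  assumes "dist x y < 1" "k \<le> 0"
  shows "fls_nth x k = fls_nth y k"
proof (cases "x = y")
  case False
  have "k < fls_subdegree (x - y)"
  proof (rule ccontr)
    assume "\<not> k < fls_subdegree (x - y)"
    with assms(2) have le: "fls_subdegree (x - y) \<le> 0" by simp
    have "(1::real) \<le> 2 ^ nat (- fls_subdegree (x - y))" by simp
    with le have "dist x y \<ge> 1" using False
      by (cases "fls_subdegree (x - y) = 0") (auto simp: dist_fls_def)
    with assms(1) show False by simp
  qed
  then have "fls_nth (x - y) k = 0" by (rule fls_eq0_below_subdegree)
  then show ?thesis by simp
qed simp

section \<open>Numbering the principal parts\<close>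

definition prpart_index :: "'a::comm_ring_1 fls \<Rightarrow> nat" where
  "prpart_index x = to_nat_on (range (fls_prpart :: 'a fls \<Rightarrow> 'a poly)) (fls_prpart x)"

lemma countable_range_prpart: "countable (range (fls_prpart :: 'a::{comm_ring_1, countable} fls \<Rightarrow> 'a poly))"
proof -
  have "p \<in> range Poly" for p :: "'a poly"
    using Poly_coeffs[of p] by (metis rangeI)
  then have "(UNIV :: 'a poly set) = range Poly" by blast
  then have "countable (UNIV :: 'a poly set)" by (metis countable_image countableI_type)
  then show ?thesis by (rule countable_subset[rotated]) simp
qed

lemma infinite_range_prpart: "infinite (range (fls_prpart :: 'a::comm_ring_1 fls \<Rightarrow> 'a poly))"
proof -
  have "inj (\<lambda>n. fls_prpart (fls_X_intpow (- int (Suc n)) :: 'a fls))"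
  proof (rule injI)
    fix m n assume "fls_prpart (fls_X_intpow (- int (Suc m)) :: 'a fls) = fls_prpart (fls_X_intpow (- int (Suc n)))"
    then have "Polynomial.coeff (fls_prpart (fls_X_intpow (- int (Suc m)) :: 'a fls)) (Suc m) =
        Polynomial.coeff (fls_prpart (fls_X_intpow (- int (Suc n)))) (Suc m)" by (rule arg_cong)
    then show "m = n" by (simp split: if_splits)
  qed
  from range_inj_infinite[OF this] show ?thesis
    by (rule contrapos_nn) (erule finite_subset[rotated], blast)
qed

text \<open>\<open>to_nat_on\<close> exhausts the naturals because the set of principal parts is
  infinite, by the monomials of negative degree, and countable, by finite coefficient lists.\<close>

lemma surj_prpart_index: "surj (prpart_index :: 'a::{comm_ring_1, countable} fls \<Rightarrow> nat)"
  using image_to_nat_on[OF countable_range_prpart infinite_range_prpart]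
  unfolding prpart_index_def by (simp add: image_image)

lemma prpart_index_eq_iff:
  fixes x y :: "'a::{comm_ring_1, countable} fls"
  shows "prpart_index x = prpart_index y \<longleftrightarrow> (\<forall>k<0. fls_nth x k = fls_nth y k)"
proof -
  have "prpart_index x = prpart_index y \<longleftrightarrow> fls_prpart x = fls_prpart y"
    unfolding prpart_index_def by (rule to_nat_on_inj[OF countable_range_prpart]) auto
  also have "\<dots> \<longleftrightarrow> (\<forall>k<0. fls_nth x k = fls_nth y k)"
  proof (intro iffI allI impI)
    fix k :: int assume "fls_prpart x = fls_prpart y" "k < 0"
    then show "fls_nth x k = fls_nth y k"
      using fls_prpart_coeff[of x "nat (- k)"] fls_prpart_coeff[of y "nat (- k)"] by simp
  qed (auto simp: poly_eq_iff)
  finally show ?thesis .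
qed

section \<open>The cocycle satisfies the assumptions of \<open>twisted_regular\<close>\<close>

lemma twisted_regular_eta:
  fixes s :: "nat \<Rightarrow> nat"
  assumes n0: "n0 \<ge> 1" "s n0 = 1" and N: "\<And>n. n \<ge> 1 \<Longrightarrow> s n \<noteq> 0 \<Longrightarrow> n \<le> N"
  shows "twisted_regular (eta s :: 'p::prime_card mod_ring fls \<Rightarrow> _)
    (\<lambda>w. mod_ring_character (low_coeff_sum N w)) prpart_index (mod_ring_character (1 :: 'p mod_ring))"
proof
  fix x y z :: "'p mod_ring fls"
  show "eta s (x + y) z = eta s x z + eta s y z" by (rule eta_add_left)
  show "eta s z (x + y) = eta s z x + eta s z y" by (rule eta_add_right)
  show "surj (prpart_index :: 'p mod_ring fls \<Rightarrow> nat)" by (rule surj_prpart_index)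
  \<comment> \<open>On the unit ball around \<open>x\<close> all coefficients of negative index are
    constant.\<close>
  show "\<exists>U. open U \<and> x \<in> U \<and> (\<forall>x'\<in>U. prpart_index x' = prpart_index x)"
    by (rule exI[of _ "ball x 1"])
      (auto simp: prpart_index_eq_iff dist_commute intro!: fls_nth_eq_if_dist_less_1)
  show "\<exists>U. open U \<and> x \<in> U \<and> (\<forall>w'\<in>U. mod_ring_character (low_coeff_sum N w') =
      mod_ring_character (low_coeff_sum N x))"
    by (rule exI[of _ "ball x 1"])
      (auto simp: dist_commute intro!: fls_nth_eq_if_dist_less_1 arg_cong[where f = mod_ring_character]
        low_coeff_sum_cong)
  assume xy: "prpart_index x = prpart_index y"
  then have xy': "fls_nth x k = fls_nth y k" if "k < 0" for k
    using that by (simp add: prpart_index_eq_iff)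
  show "prpart_index (x + z) = prpart_index (y + z)"
    using xy by (simp add: prpart_index_eq_iff)
  have "fls_nth (eta s x z) k = fls_nth (eta s y z) k" if "k < - int N" for k
    by (rule fls_nth_eta_cong) (use that xy' in simp)
  then show "mod_ring_character (low_coeff_sum N (eta s x z)) = mod_ring_character (low_coeff_sum N (eta s y z))"
    by (intro arg_cong[where f = mod_ring_character] low_coeff_sum_cong)
  \<comment> \<open>Here the cut-off at \<open>- int N\<close> matters: the index
    \<open>k + n\<close> in the second argument stays negative because \<open>n \<le> N\<close> on
    the support of \<open>s\<close>.\<close>
  have "fls_nth (eta s z x) k = fls_nth (eta s z y) k" if "k < - int N" for k
  proof (rule fls_nth_eta_cong)
    fix n assume "n \<ge> 1" "s n \<noteq> 0"
    with N[of n] that have "k + int n < 0" by simp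
    then show "fls_nth z (k - int n) * fls_nth x (k + int n) = fls_nth z (k - int n) * fls_nth y (k + int n)"
      by (simp only: xy')
  qed
  then show "mod_ring_character (low_coeff_sum N (eta s z x)) = mod_ring_character (low_coeff_sum N (eta s z y))"
    by (intro arg_cong[where f = mod_ring_character] low_coeff_sum_cong)
next
  fix F :: "nat set" assume F: "finite F"
  define e where "e = inv_into UNIV (prpart_index :: 'p mod_ring fls \<Rightarrow> nat)"
  have e: "prpart_index (e i) = i" for i
    unfolding e_def by (rule f_inv_into_f) (use surj_prpart_index in blast)
  \<comment> \<open>\<open>m\<close> bounds from below the degrees in the finitely many principal
    parts numbered by \<open>F\<close>. Inserting 0 keeps it nonpositive, so below \<open>m\<close>
    a series agrees with its representative.\<close>
  obtain m where m: "m \<le> 0" "\<And>i. i \<in> F \<Longrightarrow> m \<le> fls_subdegree (e i)"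
  proof
    show "Min (insert 0 ((\<lambda>i. fls_subdegree (e i)) ` F)) \<le> 0" using F by simp
    show "Min (insert 0 ((\<lambda>i. fls_subdegree (e i)) ` F)) \<le> fls_subdegree (e i)" if "i \<in> F" for i
      using F that by simp
  qed
  have low: "fls_nth y k = 0" if "prpart_index y \<in> F" "k < m" for y :: "'p mod_ring fls" and k
  proof -
    have "fls_nth y k = fls_nth (e (prpart_index y)) k"
      using e[of "prpart_index y"] that m(1) unfolding prpart_index_eq_iff by simp
    then show ?thesis using m(2)[OF that(1)] that(2) by simp
  qed
  \<comment> \<open>If \<open>k - n = a\<close> then \<open>k + n = a + 2 * n\<close> is at most
    \<open>- L + 3 * N = m - 1\<close>, where series numbered by \<open>F\<close> have zero
    coefficients. Moreover \<open>- L < - N\<close>, so the monomial at \<open>- L\<close> is seen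
    by \<open>low_coeff_sum\<close>.\<close>
  define L where "L = 3 * int N + 1 - m"
  define u v :: "'p mod_ring fls"
    where "u = fls_X_intpow (- L - int n0)" and "v = fls_X_intpow (- L + int n0)"
  have n0N: "n0 \<le> N" using N n0 by simp
  have X: "eta s (fls_X_intpow a) y = 0 \<and> eta s y (fls_X_intpow a) = 0"
    if "prpart_index y \<in> F" and a: "a \<le> - L + int n0" for y :: "'p mod_ring fls" and a
  proof (intro conjI fls_eqI)
    fix k
    show "fls_nth (eta s (fls_X_intpow a) y) k = fls_nth 0 k"
      unfolding fls_zero_nth
    proof (rule fls_nth_eta_eq_0)
      fix n assume "n \<ge> 1" "s n \<noteq> 0"
      with N have "n \<le> N" by simp
      then have "k + int n < m" if "k - int n = a" using a n0N m(1) that by (simp add: L_def)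
      then show "fls_nth (fls_X_intpow a) (k - int n) * fls_nth y (k + int n) = 0"
        unfolding fls_nth_X_intpow using low[OF that(1)] by simp
    qed
    show "fls_nth (eta s y (fls_X_intpow a)) k = fls_nth 0 k"
      unfolding fls_zero_nth
    proof (rule fls_nth_eta_eq_0)
      fix n assume "n \<ge> 1" "s n \<noteq> 0"
      have "k - int n < m" if "k + int n = a" using a n0N m(1) that by (simp add: L_def)
      then show "fls_nth y (k - int n) * fls_nth (fls_X_intpow a) (k + int n) = 0"
        unfolding fls_nth_X_intpow using low[OF that(1)] by simp
    qed
  qed
  \<comment> \<open>The indices force \<open>k = - L\<close> and \<open>n = n0\<close>. In the
    reverse order they would force \<open>n = - n0\<close>, so \<open>eta s v u\<close>
    vanishes.\<close>
  have uv: "eta s u v = fls_X_intpow (- L)"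
  proof (rule fls_eqI)
    fix k
    define M where "M = nat (max (int n0) (k - fls_subdegree u))"
    have M: "k - fls_subdegree u \<le> int M" "n0 \<le> M" by (auto simp: M_def)
    have "of_nat (s n) * (fls_nth u (k - int n) * fls_nth v (k + int n)) =
        (if n = n0 then if k = - L then 1 else 0 else 0)" for n
      unfolding u_def v_def fls_nth_X_intpow using n0(2) by auto
    then show "fls_nth (eta s u v) k = fls_nth (fls_X_intpow (- L)) k"
      unfolding fls_nth_eta[OF M(1)] fls_nth_X_intpow using M(2) n0(1) by simp
  qed
  have vu: "eta s v u = 0"
  proof (rule fls_eqI)
    fix k show "fls_nth (eta s v u) k = fls_nth 0 k"
      unfolding fls_zero_nth u_def v_def
      by (rule fls_nth_eta_eq_0, unfold fls_nth_X_intpow) (use n0 in auto)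
  qed
  \<comment> \<open>The monomial at \<open>- L\<close> contributes exactly 1, so the resulting
    scalar is the character value at 1, whatever \<open>L\<close> is.\<close>
  have "{k. k < - int N \<and> fls_nth (fls_X_intpow (- L) :: 'p mod_ring fls) k \<noteq> 0} = {- L}"
    unfolding fls_nth_X_intpow using m(1) by (auto simp: L_def)
  then have "low_coeff_sum N (fls_X_intpow (- L) :: 'p mod_ring fls) = 1"
    unfolding low_coeff_sum_def by simp
  moreover have "low_coeff_sum N (0 :: 'p mod_ring fls) = 0"
    by (rule low_coeff_sum_eq_0) simp
  moreover have "eta s u y = 0" "eta s y u = 0" "eta s v y = 0" "eta s y v = 0"
    if "prpart_index y \<in> F" for y
    unfolding u_def v_def using X[OF that, of "- L - int n0"] X[OF that, of "- L + int n0"] by simp_all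
  ultimately have "mod_ring_character (low_coeff_sum N (eta s u v)) =
        mod_ring_character (1 :: 'p mod_ring) * mod_ring_character (low_coeff_sum N (eta s v u)) \<and>
      (\<forall>y. prpart_index y \<in> F \<longrightarrow>
        mod_ring_character (low_coeff_sum N (eta s u y)) = mod_ring_character (low_coeff_sum N (eta s y u)) \<and>
        mod_ring_character (low_coeff_sum N (eta s v y)) = mod_ring_character (low_coeff_sum N (eta s y v)))"
    by (simp add: uv vu)
  then show "\<exists>u v :: 'p mod_ring fls. mod_ring_character (low_coeff_sum N (eta s u v)) =
        mod_ring_character (1 :: 'p mod_ring) * mod_ring_character (low_coeff_sum N (eta s v u)) \<and>
      (\<forall>y. prpart_index y \<in> F \<longrightarrow>
        mod_ring_character (low_coeff_sum N (eta s u y)) = mod_ring_character (low_coeff_sum N (eta s y u)) \<and>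
        mod_ring_character (low_coeff_sum N (eta s v y)) = mod_ring_character (low_coeff_sum N (eta s y v)))"
    by blast
qed (auto simp: low_coeff_sum_add mod_ring_character_add mod_ring_character_1)

theorem theorem5p9:
  fixes s :: "nat \<Rightarrow> nat"
  assumes "\<forall>n\<ge>1. s n \<in> {0, 1}"
    and "\<exists>n\<ge>1. s n \<noteq> 0"
    and "finite {n. n \<ge> 1 \<and> s n \<noteq> 0}"
  shows "\<not> type_I_group TYPE(nat \<Rightarrow> complex)
    (central_extension (eta s :: 'p::prime_card mod_ring fls \<Rightarrow> 'p mod_ring fls \<Rightarrow> 'p mod_ring fls))
    (prod_topology euclidean euclidean)"
proof -
  obtain n0 where n0: "n0 \<ge> 1" "s n0 = 1" using assms(1,2) by auto
  obtain N where "\<And>n. n \<ge> 1 \<Longrightarrow> s n \<noteq> 0 \<Longrightarrow> n \<le> N"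
    using assms(3) unfolding finite_nat_set_iff_bounded_le by auto
  with n0 have "twisted_regular (eta s :: 'p mod_ring fls \<Rightarrow> _)
    (\<lambda>w. mod_ring_character (low_coeff_sum N w)) prpart_index (mod_ring_character (1 :: 'p mod_ring))"
    by (rule twisted_regular_eta)
  then show ?thesis by (rule twisted_regular.not_type_I)
qed

end
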